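(* Let $0<q<1$, $l>0$ and $0<\psi\le2\pi$. Consider the bounded selfadjoint operator on $\mathcal H_l$ $$I_2^{(\psi)}=q^{3J_0/4}\bigl(e^{\mathrm i\psi}J_++e^{-\mathrm i\psi}J_-\bigr)q^{3J_0/4}-\bigl([J_0-l]_q\,q^{(l-1)/2}+[J_0+l]_q\,q^{-(l-1)/2}\bigr)q^{3J_0/2}.$$ Then $I_2^{(\psi)}$ has a simple discrete (point) spectrum, which consists of the points $\lambda_n=\frac{q^n}{1-q^{-1}}$, $n=0,1,2,\dots$, and the corresponding eigenfunctions $$\Xi^l_n(x)=\sum_{k=0}^\infty P_k(\lambda_n)\,f^l_k(x;q),\qquad P_k(\lambda)=e^{\mathrm ik\psi}\left(\frac{(q^{2l};q)_k}{(q;q)_k}\right)^{1/2}q^{-lk}\,p_k\bigl((1-q^{-1})\lambda;\,q^{2l-1}\big|q\bigr),$$ $n=0,1,2,\dots$, constitute an orthogonal basis of $\mathcal H_l$. Here $p_k(\cdot\,;a|q)$ are the little $q$-Laguerre (Wall) polynomials.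
   Context: Notation: $(a;q)_n=\prod_{r=0}^{n-1}(1-aq^r)$, $[c]_q=\frac{q^{c/2}-q^{-c/2}}{q^{1/2}-q^{-1/2}}$, where $c$ may be a number or an operator. Discrete series representation $T_l^+$ of $U_q(\mathrm{su}_{1,1})$ ($l>0$): $\mathcal H_l$ is the Hilbert space with orthonormal basis the monomials $f^l_n(x;q)=c^l_n(q)x^n$, $n=0,1,2,\dots$, where $c^l_n(q)=q^{(1-2l)n/4}\left(\frac{(q^{2l};q)_n}{(q;q)_n}\right)^{1/2}$. The operators act by $J_0f^l_n=(l+n)f^l_n$, $J_+f^l_n=\sqrt{[2l+n]_q[n+1]_q}\,f^l_{n+1}$, $J_-f^l_n=\sqrt{[2l+n-1]_q[n]_q}\,f^l_{n-1}$; functions of $J_0$ act diagonally, e.g. $[J_0\pm l]_qf^l_n=[l+n\pm l]_qf^l_n$ and $q^{cJ_0}f^l_n=q^{c(l+n)}f^l_n$. Little $q$-Laguerre polynomials: $p_k(x;a|q)=\sum_{j=0}^k\frac{(q^{-k};q)_j}{(aq;q)_j(q;q)_j}(qx)^j$. "Discrete spectrum consisting of the points $\lambda_n$" means that the $\lambda_n$ are exactly the eigenvalues, each of multiplicity one, and the eigenvectors are complete (the accumulation point $0$ of the eigenvalues is disregarded). *)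

theory Defs
  imports Complex_Main "HOL-Computational_Algebra.Formal_Power_Series"
begin

definition qpoch :: "real \<Rightarrow> real \<Rightarrow> nat \<Rightarrow> real" where
  "qpoch a q n = (\<Prod>r<n. 1 - a * q ^ r)"

definition qnum :: "real \<Rightarrow> real \<Rightarrow> real" where
  "qnum q c = (q powr (c / 2) - q powr (- c / 2)) / (q powr (1 / 2) - q powr (- 1 / 2))"

definition little_q_laguerre :: "real \<Rightarrow> real \<Rightarrow> nat \<Rightarrow> real \<Rightarrow> real" where
  "little_q_laguerre q a k x =
     (\<Sum>j\<le>k. qpoch (q powr (- real k)) q j / (qpoch (a * q) q j * qpoch q q j) * (q * x) ^ j)"


text \<open>
  The vectors are complex power series in the variable x, with complex scalars acting through
  constant series. This gives access to the library notions of span and dimension over the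
  complex field.
\<close>

definition cscale :: "complex \<Rightarrow> complex fps \<Rightarrow> complex fps" where
  "cscale c F = fps_const c * F"

interpretation cfps: vector_space cscale
  by standard
    (simp_all add: cscale_def algebra_simps flip: fps_const_add fps_const_mult)

definition f_coeff :: "real \<Rightarrow> real \<Rightarrow> nat \<Rightarrow> real" where
  "f_coeff q l n =
     q powr ((1 - 2 * l) * real n / 4) * sqrt (qpoch (q powr (2 * l)) q n / qpoch q q n)"

definition f_basis :: "real \<Rightarrow> real \<Rightarrow> nat \<Rightarrow> complex fps" where
  "f_basis q l n = cscale (of_real (f_coeff q l n)) (fps_X ^ n)"

text \<open>
  For \<^term>\<open>0 < q\<close>, \<^term>\<open>q < 1\<close> and \<^term>\<open>0 < l\<close> the numbers \<^term>\<open>f_coeff q l n\<close> are positive, so every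
  power series has unique coordinates with respect to the \<^term>\<open>f_basis q l n\<close>. The Hilbert space
  consists of the series with square-summable coordinates; this makes \<^term>\<open>f_basis q l\<close> an
  orthonormal basis of it.
\<close>

definition f_coord :: "real \<Rightarrow> real \<Rightarrow> complex fps \<Rightarrow> nat \<Rightarrow> complex" where
  "f_coord q l F n = fps_nth F n / of_real (f_coeff q l n)"

definition f_series :: "real \<Rightarrow> real \<Rightarrow> (nat \<Rightarrow> complex) \<Rightarrow> complex fps" where
  "f_series q l a = Abs_fps (\<lambda>n. a n * of_real (f_coeff q l n))"

definition hl_space :: "real \<Rightarrow> real \<Rightarrow> complex fps set" where
  "hl_space q l = {F. summable (\<lambda>n. (cmod (f_coord q l F n))\<^sup>2)}"

definition hl_inner :: "real \<Rightarrow> real \<Rightarrow> complex fps \<Rightarrow> complex fps \<Rightarrow> complex" where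
  "hl_inner q l F G = (\<Sum>n. f_coord q l F n * cnj (f_coord q l G n))"

definition hl_norm :: "real \<Rightarrow> real \<Rightarrow> complex fps \<Rightarrow> real" where
  "hl_norm q l F = sqrt (Re (hl_inner q l F F))"

definition hl_sums :: "real \<Rightarrow> real \<Rightarrow> (nat \<Rightarrow> complex fps) \<Rightarrow> complex fps \<Rightarrow> bool" where
  "hl_sums q l g F \<longleftrightarrow> F \<in> hl_space q l \<and> (\<forall>k. g k \<in> hl_space q l) \<and>
     (\<lambda>N. hl_norm q l ((\<Sum>k<N. g k) - F)) \<longlonglongrightarrow> 0"

definition hl_bounded_selfadjoint ::
    "real \<Rightarrow> real \<Rightarrow> (complex fps \<Rightarrow> complex fps) \<Rightarrow> bool" where
  "hl_bounded_selfadjoint q l T \<longleftrightarrow>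
     (\<forall>F\<in>hl_space q l. T F \<in> hl_space q l) \<and>
     (\<forall>F\<in>hl_space q l. \<forall>G\<in>hl_space q l. T (F + G) = T F + T G) \<and>
     (\<forall>c. \<forall>F\<in>hl_space q l. T (cscale c F) = cscale c (T F)) \<and>
     (\<exists>C. \<forall>F\<in>hl_space q l. hl_norm q l (T F) \<le> C * hl_norm q l F) \<and>
     (\<forall>F\<in>hl_space q l. \<forall>G\<in>hl_space q l. hl_inner q l (T F) G = hl_inner q l F (T G))"

definition hl_dense_span :: "real \<Rightarrow> real \<Rightarrow> complex fps set \<Rightarrow> bool" where
  "hl_dense_span q l S \<longleftrightarrow>
     (\<forall>F\<in>hl_space q l. \<forall>e>0. \<exists>G\<in>cfps.span S. hl_norm q l (F - G) < e)"

definition hl_orthogonal_basis :: "real \<Rightarrow> real \<Rightarrow> (nat \<Rightarrow> complex fps) \<Rightarrow> bool" where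
  "hl_orthogonal_basis q l v \<longleftrightarrow>
     (\<forall>n. v n \<in> hl_space q l \<and> v n \<noteq> 0) \<and>
     (\<forall>m n. m \<noteq> n \<longrightarrow> hl_inner q l (v m) (v n) = 0) \<and>
     hl_dense_span q l (range v)"

definition hl_eigenspace ::
    "real \<Rightarrow> real \<Rightarrow> (complex fps \<Rightarrow> complex fps) \<Rightarrow> complex \<Rightarrow> complex fps set" where
  "hl_eigenspace q l T \<mu> = {F \<in> hl_space q l. T F = cscale \<mu> F}"

definition hl_eigenvector ::
    "real \<Rightarrow> real \<Rightarrow> (complex fps \<Rightarrow> complex fps) \<Rightarrow> complex \<Rightarrow> complex fps \<Rightarrow> bool" where
  "hl_eigenvector q l T \<mu> F \<longleftrightarrow> F \<in> hl_eigenspace q l T \<mu> \<and> F \<noteq> 0"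

text \<open>
  The eigenvalues are exactly the given points, each of multiplicity one, and the eigenvectors
  are complete. Accumulation points of the eigenvalues are not counted.
\<close>

definition hl_simple_discrete_spectrum ::
    "real \<Rightarrow> real \<Rightarrow> (complex fps \<Rightarrow> complex fps) \<Rightarrow> (nat \<Rightarrow> complex) \<Rightarrow> bool" where
  "hl_simple_discrete_spectrum q l T ev \<longleftrightarrow>
     {\<mu>. \<exists>F. hl_eigenvector q l T \<mu> F} = range ev \<and>
     (\<forall>n. cfps.dim (hl_eigenspace q l T (ev n)) = 1) \<and>
     hl_dense_span q l {F. \<exists>\<mu>. hl_eigenvector q l T \<mu> F}"


text \<open>
  The representation operators are extended from the basis to all power series, coordinate by
  coordinate. The raising and lowering operators are unbounded on the Hilbert space, but the
  factors \<^term>\<open>q powr (3 * t / 4)\<close> at \<^term>\<open>J\<^sub>0\<close> compensate for their growth, so that the products in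
  \<open>I2\<close> below are everywhere defined there. A function \<^term>\<open>h\<close> of \<^term>\<open>J\<^sub>0\<close> multiplies the
  basis vector number n by \<^term>\<open>h (l + real n)\<close>.
\<close>

definition fun_J0 :: "real \<Rightarrow> real \<Rightarrow> (real \<Rightarrow> real) \<Rightarrow> complex fps \<Rightarrow> complex fps" where
  "fun_J0 q l h F = f_series q l (\<lambda>n. of_real (h (l + real n)) * f_coord q l F n)"

definition J_plus :: "real \<Rightarrow> real \<Rightarrow> complex fps \<Rightarrow> complex fps" where
  "J_plus q l F = f_series q l (\<lambda>n. case n of 0 \<Rightarrow> 0 | Suc m \<Rightarrow>
     of_real (sqrt (qnum q (2 * l + real m) * qnum q (real m + 1))) * f_coord q l F m)"

definition J_minus :: "real \<Rightarrow> real \<Rightarrow> complex fps \<Rightarrow> complex fps" where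
  "J_minus q l F = f_series q l (\<lambda>n.
     of_real (sqrt (qnum q (2 * l + real (Suc n) - 1) * qnum q (real (Suc n)))) * f_coord q l F (Suc n))"

definition I2 :: "real \<Rightarrow> real \<Rightarrow> real \<Rightarrow> complex fps \<Rightarrow> complex fps" where
  "I2 q l \<psi> F =
     (let q34 = fun_J0 q l (\<lambda>t. q powr (3 * t / 4));
          q32 = fun_J0 q l (\<lambda>t. q powr (3 * t / 2)) in
      q34 (cscale (exp (\<i> * of_real \<psi>)) (J_plus q l (q34 F))
           + cscale (exp (- \<i> * of_real \<psi>)) (J_minus q l (q34 F)))
      - (cscale (of_real (q powr ((l - 1) / 2))) (fun_J0 q l (\<lambda>t. qnum q (t - l)) (q32 F))
         + cscale (of_real (q powr (- (l - 1) / 2))) (fun_J0 q l (\<lambda>t. qnum q (t + l)) (q32 F))))"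

definition I2_ev :: "real \<Rightarrow> nat \<Rightarrow> real" where
  "I2_ev q n = q ^ n / (1 - inverse q)"

definition P_coeff :: "real \<Rightarrow> real \<Rightarrow> real \<Rightarrow> nat \<Rightarrow> real \<Rightarrow> complex" where
  "P_coeff q l \<psi> k x =
     exp (\<i> * of_nat k * of_real \<psi>) *
     of_real (sqrt (qpoch (q powr (2 * l)) q k / qpoch q q k) * q powr (- l * real k) *
       little_q_laguerre q (q powr (2 * l - 1)) k ((1 - inverse q) * x))"

definition Xi :: "real \<Rightarrow> real \<Rightarrow> real \<Rightarrow> nat \<Rightarrow> complex fps" where
  "Xi q l \<psi> n = f_series q l (\<lambda>k. P_coeff q l \<psi> k (I2_ev q n))"


text \<open>
  Consistency of the encoding: orthonormality of the basis, and the action of the operators on it.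
\<close>

lemma qpoch_pos:
  assumes "0 < q" "q < 1" "0 \<le> a" "a < 1"
  shows "qpoch a q n > 0"
proof -
  have "a * q ^ r < 1" for r
    using assms by (meson le_less_trans less_eq_real_def mult_left_le power_le_one)
  then show ?thesis by (auto simp: qpoch_def intro!: prod_pos)
qed

lemma f_coeff_pos:
  assumes "0 < q" "q < 1" "0 < l"
  shows "f_coeff q l n > 0"
proof -
  have "q powr (2 * l) < 1"
    using assms powr_less_mono2[of "2 * l" q 1] by simp
  then show ?thesis
    using assms by (simp add: f_coeff_def qpoch_pos)
qed

lemma f_coord_series:
  assumes "0 < q" "q < 1" "0 < l"
  shows "f_coord q l (f_series q l a) n = a n"
  using f_coeff_pos[OF assms, of n] by (simp add: f_coord_def f_series_def)

lemma f_series_coord: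
  assumes "0 < q" "q < 1" "0 < l"
  shows "f_series q l (f_coord q l F) = F"
  using f_coeff_pos[OF assms] by (simp add: f_coord_def f_series_def fps_eq_iff less_imp_neq[symmetric])

lemma f_coord_basis:
  assumes "0 < q" "q < 1" "0 < l"
  shows "f_coord q l (f_basis q l m) n = (if n = m then 1 else 0)"
  using f_coeff_pos[OF assms, of m] by (simp add: f_coord_def f_basis_def cscale_def)

lemma f_basis_orthonormal:
  assumes "0 < q" "q < 1" "0 < l"
  shows "f_basis q l m \<in> hl_space q l"
    and "hl_inner q l (f_basis q l m) (f_basis q l n) = (if m = n then 1 else 0)"
proof -
  have "(\<lambda>k. (cmod (f_coord q l (f_basis q l m) k))\<^sup>2) = (\<lambda>k. if k = m then 1 else 0)"
    by (auto simp: f_coord_basis[OF assms])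
  then show "f_basis q l m \<in> hl_space q l"
    by (simp add: hl_space_def)
  have "(\<lambda>k. f_coord q l (f_basis q l m) k * cnj (f_coord q l (f_basis q l n) k)) =
      (\<lambda>k. if k = m then (if m = n then 1 else 0) else 0)"
    by (auto simp: f_coord_basis[OF assms])
  then show "hl_inner q l (f_basis q l m) (f_basis q l n) = (if m = n then 1 else 0)"
    using sums_single[of m "\<lambda>_. if m = n then 1 else 0 :: complex"]
    by (simp add: hl_inner_def sums_iff)
qed

lemma fps_eq_f_coordI:
  assumes "0 < q" "q < 1" "0 < l" "\<And>n. f_coord q l F n = f_coord q l G n"
  shows "F = G"
  using assms f_series_coord[OF assms(1-3)] by (metis ext)

lemma f_coord_cscale: "f_coord q l (cscale c F) n = c * f_coord q l F n"
  by (simp add: f_coord_def cscale_def)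

lemma operators_on_basis:
  assumes "0 < q" "q < 1" "0 < l"
  shows "fun_J0 q l h (f_basis q l n) = cscale (of_real (h (l + real n))) (f_basis q l n)"
    and "J_plus q l (f_basis q l n) =
      cscale (of_real (sqrt (qnum q (2 * l + real n) * qnum q (real n + 1)))) (f_basis q l (Suc n))"
    and "J_minus q l (f_basis q l (Suc n)) =
      cscale (of_real (sqrt (qnum q (2 * l + real (Suc n) - 1) * qnum q (real (Suc n))))) (f_basis q l n)"
    and "J_minus q l (f_basis q l 0) = 0"
proof -
  note s = f_coord_series[OF assms] f_coord_basis[OF assms] f_coord_cscale
  show "fun_J0 q l h (f_basis q l n) = cscale (of_real (h (l + real n))) (f_basis q l n)"
    by (rule fps_eq_f_coordI[OF assms]) (simp add: fun_J0_def s)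
  show "J_plus q l (f_basis q l n) =
      cscale (of_real (sqrt (qnum q (2 * l + real n) * qnum q (real n + 1)))) (f_basis q l (Suc n))"
    by (rule fps_eq_f_coordI[OF assms]) (simp add: J_plus_def s split: nat.split)
  show "J_minus q l (f_basis q l (Suc n)) =
      cscale (of_real (sqrt (qnum q (2 * l + real (Suc n) - 1) * qnum q (real (Suc n))))) (f_basis q l n)"
    by (rule fps_eq_f_coordI[OF assms]) (simp add: J_minus_def s)
  show "J_minus q l (f_basis q l 0) = 0"
    by (simp add: J_minus_def s f_series_def fps_eq_iff)
qed

end

theory Submission imports Defs begin

text \<open>
  In the basis \<open>f\<^sub>k\<close> the operator \<open>I\<^sub>2\<close> is a bounded Jacobi matrix, a multiple \<open>- q / (1 - q)\<close> of the one
  that describes multiplication by \<open>x\<close> on the normalised little q-Laguerre polynomials \<open>u\<^sub>k\<close>. Up to phases,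
  \<open>\<Xi>\<^sub>n = (u\<^sub>k(q\<^sup>n))\<^sub>k\<close> is therefore a formal eigenvector. The \<open>u\<^sub>k\<close> are orthogonal with respect to the
  masses \<open>w\<^sub>n\<close> at \<open>q\<^sup>n\<close>, of total mass \<open>E\<close>. Bessel's inequality for this system, applied to a unit mass at
  \<open>q\<^sup>n\<close>, gives \<open>\<parallel>\<Xi>\<^sub>n\<parallel>\<^sup>2 \<le> E / w\<^sub>n\<close>, so no asymptotics of the polynomials is needed. Eigenvectors for
  different eigenvalues are orthogonal, so
  \<open>\<parallel>f\<^sub>j - \<Sum>n<N. (w\<^sub>n / E) u\<^sub>j(q\<^sup>n) \<Xi>\<^sub>n\<parallel>\<^sup>2 \<le> 1 - \<Sum>n<N. (w\<^sub>n / E) u\<^sub>j(q\<^sup>n)\<^sup>2 \<longlonglongrightarrow> 0\<close>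
  (again up to phases), which proves completeness; a further eigenvector would be orthogonal to all \<open>\<Xi>\<^sub>n\<close>.
\<close>

section \<open>Little q-Laguerre polynomials\<close>

lemma qpoch_0 [simp]: "qpoch a q 0 = 1"
  by (simp add: qpoch_def)

lemma qpoch_Suc: "qpoch a q (Suc n) = qpoch a q n * (1 - a * q ^ n)"
  by (simp add: qpoch_def)

lemma qpoch_Suc_shift: "qpoch a q (Suc n) = (1 - a) * qpoch (a * q) q n"
  by (simp add: qpoch_def prod.lessThan_Suc_shift mult.assoc del: prod.lessThan_Suc)

lemma qpoch_eq_0:
  assumes "a * q ^ r = 1" "r < n"
  shows "qpoch a q n = 0"
  using assms by (auto simp: qpoch_def)

text \<open>The parameter \<alpha> will be q^(2l-1), which exceeds 1 when l < 1/2. The condition on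
  \<open>\<alpha> * q\<close> keeps all factors of \<open>qpoch (\<alpha> * q) q\<close> positive
  and makes the masses \<open>w\<close> below summable.\<close>

locale wall =
  fixes q \<alpha> :: real
  assumes q_pos: "0 < q" and q_less_1: "q < 1" and \<alpha>_pos: "0 < \<alpha>" and \<alpha>q_less_1: "\<alpha> * q < 1"
begin

text \<open>The coefficient of x^j in the polynomial of index k. It vanishes for j > k, so
  polynomials of different degrees can be summed over one common range.\<close>

definition wall_coeff :: "nat \<Rightarrow> nat \<Rightarrow> real" where
  "wall_coeff k j = qpoch (inverse (q ^ k)) q j / (qpoch (\<alpha> * q) q j * qpoch q q j) * q ^ j"

abbreviation (input) p :: "nat \<Rightarrow> real \<Rightarrow> real" where
  "p \<equiv> little_q_laguerre q \<alpha>"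

lemma aq_power_less_1: "\<alpha> * q * q ^ n < 1"
  using q_pos q_less_1 \<alpha>_pos \<alpha>q_less_1
  by (meson le_less_trans less_eq_real_def mult_left_le power_le_one mult_pos_pos)

lemma q_power_Suc_less_1: "q * q ^ n < 1"
  using q_pos q_less_1 power_Suc_less_one[of q n] by simp

lemma qpoch_a_pos: "qpoch (\<alpha> * q) q n > 0"
  using q_pos q_less_1 \<alpha>_pos \<alpha>q_less_1 by (intro qpoch_pos) auto

lemma qpoch_q_pos: "qpoch q q n > 0"
  using q_pos q_less_1 by (intro qpoch_pos) auto

lemma qpoch_inverse_eq_0: "k < j \<Longrightarrow> qpoch (inverse (q ^ k)) q j = 0"
  using q_pos by (intro qpoch_eq_0[of _ _ k]) auto

lemma wall_coeff_0 [simp]: "wall_coeff k 0 = 1"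
  by (simp add: wall_coeff_def)

lemma wall_coeff_eq_0: "k < j \<Longrightarrow> wall_coeff k j = 0"
  by (simp add: wall_coeff_def qpoch_inverse_eq_0)

lemma wall_eq:
  assumes "k \<le> N"
  shows "p k x = (\<Sum>j\<le>N. wall_coeff k j * x ^ j)"
proof -
  have "p k x = (\<Sum>j\<le>k. wall_coeff k j * x ^ j)"
    using q_pos
    by (simp add: little_q_laguerre_def wall_coeff_def powr_minus powr_realpow power_mult_distrib mult_ac)
  also have "\<dots> = (\<Sum>j\<le>N. wall_coeff k j * x ^ j)"
    using assms by (intro sum.mono_neutral_left) (auto simp: wall_coeff_eq_0)
  finally show ?thesis .
qed

lemma wall_0 [simp]: "p 0 x = 1"
  using wall_eq[of 0 0 x] by simp

section \<open>Three-term recurrence\<close>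

definition A :: "nat \<Rightarrow> real" where "A k = q ^ k * (1 - \<alpha> * q * q ^ k)"
text \<open>Since \<open>C 0 = 0\<close>, the truncated index \<open>k - 1\<close> in the recurrence
  does no harm at k = 0.\<close>

definition C :: "nat \<Rightarrow> real" where "C k = \<alpha> * q ^ k * (1 - q ^ k)"

text \<open>This is the recurrence of the polynomials compared at x^(j+1). All coefficients are
  brought to the common factor \<open>Y * R\<close>; what remains is a rational identity in K = q^k,
  t = q^j, q and \<alpha>.\<close>

lemma wall_coeff_recurrence:
  "wall_coeff k j = (A k + C k) * wall_coeff k (Suc j) - A k * wall_coeff (Suc k) (Suc j)
     - C k * wall_coeff (k - 1) (Suc j)"
proof -
  define K where "K = q ^ k"
  define t where "t = q ^ j"
  define Y where "Y = qpoch (inverse K) q j"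
  define D where "D = qpoch (\<alpha> * q) q j * qpoch q q j"
  have nz: "K \<noteq> 0" "q \<noteq> 0" "D \<noteq> 0" "1 - \<alpha> * q * t \<noteq> 0" "1 - q * t \<noteq> 0"
    using q_pos qpoch_a_pos[of j] qpoch_q_pos[of j] aq_power_less_1[of j] q_power_Suc_less_1[of j]
    by (auto simp: K_def t_def D_def)
  define R where "R = t * q / (D * ((1 - \<alpha> * q * t) * (1 - q * t)))"
  have den: "qpoch (\<alpha> * q) q (Suc j) * qpoch q q (Suc j) = D * ((1 - \<alpha> * q * t) * (1 - q * t))"
    by (simp add: qpoch_Suc D_def t_def mult_ac)
  have c1: "wall_coeff k (Suc j) = Y * (1 - t / K) * R"
    unfolding wall_coeff_def den by (simp add: qpoch_Suc Y_def K_def t_def R_def field_simps)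
  have "qpoch (inverse (q ^ Suc k)) q (Suc j) = (1 - inverse (K * q)) * Y"
    unfolding qpoch_Suc_shift using nz by (simp add: K_def Y_def divide_simps mult_ac)
  then have c2: "wall_coeff (Suc k) (Suc j) = (1 - inverse (K * q)) * Y * R"
    unfolding wall_coeff_def den by (simp only: R_def t_def) simp
  \<comment> \<open>The factor \<open>1 - K\<close> is borrowed from \<open>C k\<close>. For k > 0
    it supplies \<open>1 - inverse K\<close>, which extends the product starting at q/K to the one
    starting at 1/K. For k = 0 both sides vanish: K = 1 on the left, and \<open>Y * (1 - t)\<close>
    contains the factor 1 - 1 on the right.\<close>
  have "(1 - K) * qpoch (inverse (q ^ (k - 1))) q (Suc j) = - K * Y * (1 - t / K) * (1 - q * t / K)"
  proof (cases k)
    case (Suc m)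
    then have "inverse (q ^ (k - 1)) = inverse K * q"
      using nz by (simp add: K_def)
    then have "(1 - inverse K) * qpoch (inverse (q ^ (k - 1))) q (Suc j) = qpoch (inverse K) q (Suc (Suc j))"
      using qpoch_Suc_shift[of "inverse K" q "Suc j"] by simp
    also have "\<dots> = Y * (1 - t / K) * (1 - q * t / K)"
      by (simp add: qpoch_Suc Y_def t_def divide_inverse mult_ac)
    finally have eq: "(1 - inverse K) * qpoch (inverse (q ^ (k - 1))) q (Suc j) = Y * (1 - t / K) * (1 - q * t / K)" .
    have "(1 - K) * X = - K * ((1 - inverse K) * X)" for X
      using nz by (simp add: field_simps)
    from this[of "qpoch (inverse (q ^ (k - 1))) q (Suc j)", unfolded eq] show ?thesis
      by (simp only: mult.assoc)
  next
    case 0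
    have "Y * (1 - t) = 0"
      using qpoch_eq_0[of 1 q 0 "Suc j"] by (simp add: qpoch_Suc Y_def K_def 0 t_def)
    then show ?thesis by (simp add: K_def 0)
  qed
  then have c3: "(1 - K) * wall_coeff (k - 1) (Suc j) = - K * Y * (1 - t / K) * (1 - q * t / K) * R"
    unfolding wall_coeff_def den by (simp add: R_def t_def mult.assoc[symmetric])
  have c0: "wall_coeff k j = Y * ((1 - \<alpha> * q * t) * (1 - q * t)) * R / q"
  proof -
    have "wall_coeff k j = Y / D * t"
      by (simp add: wall_coeff_def Y_def K_def D_def t_def)
    moreover have "Y * V * (t * q / (D * V)) / q = Y / D * t" if "V \<noteq> 0" for V
      using that nz by (simp add: field_simps)
    ultimately show ?thesis
      unfolding R_def using nz by simp
  qed
  have "(A k + C k) * wall_coeff k (Suc j) - A k * wall_coeff (Suc k) (Suc j) - C k * wall_coeff (k - 1) (Suc j)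
      = Y * R * ((K * (1 - \<alpha> * q * K) + \<alpha> * K * (1 - K)) * (1 - t / K)
          - K * (1 - \<alpha> * q * K) * (1 - inverse (K * q)) + \<alpha> * K * K * (1 - t / K) * (1 - q * t / K))"
  proof -
    have "C k * wall_coeff (k - 1) (Suc j) = \<alpha> * K * ((1 - K) * wall_coeff (k - 1) (Suc j))"
      by (simp add: C_def K_def)
    then have C: "C k * wall_coeff (k - 1) (Suc j) = \<alpha> * K * (- K * Y * (1 - t / K) * (1 - q * t / K) * R)"
      unfolding c3 .
    have AC: "A k = K * (1 - \<alpha> * q * K)" "C k = \<alpha> * K * (1 - K)"
      by (simp_all add: A_def C_def K_def)
    show ?thesis
      unfolding C unfolding c1 c2 AC by algebra
  qed
  also have "(K * (1 - \<alpha> * q * K) + \<alpha> * K * (1 - K)) * (1 - t / K)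
          - K * (1 - \<alpha> * q * K) * (1 - inverse (K * q)) + \<alpha> * K * K * (1 - t / K) * (1 - q * t / K)
     = (1 - \<alpha> * q * t) * (1 - q * t) / q"
    using nz by (simp add: divide_simps) algebra
  finally show ?thesis by (simp add: c0)
qed

lemma wall_recurrence:
  "x * p k x = (A k + C k) * p k x - A k * p (Suc k) x - C k * p (k - 1) x"
proof -
  let ?N = "Suc k"
  have "(A k + C k) * p k x - A k * p (Suc k) x - C k * p (k - 1) x =
    (\<Sum>j\<le>Suc ?N. ((A k + C k) * wall_coeff k j - A k * wall_coeff (Suc k) j - C k * wall_coeff (k - 1) j) * x ^ j)"
    using wall_eq[of "k - 1" "Suc ?N" x]
    by (simp add: wall_eq[of k "Suc ?N"] wall_eq[of "Suc k" "Suc ?N"]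
          sum_distrib_left algebra_simps sum.distrib sum_subtractf del: sum.atMost_Suc)
  \<comment> \<open>The constant terms cancel because every \<open>wall_coeff k 0\<close> is 1; the
    rest is reindexed by one and matched with \<open>wall_coeff_recurrence\<close>.\<close>
  also have "\<dots> = (\<Sum>j\<le>?N. wall_coeff k j * x ^ Suc j)"
    unfolding sum.atMost_Suc_shift[of _ ?N]
    by (simp add: wall_coeff_recurrence[of k, unfolded One_nat_def, symmetric] del: sum.atMost_Suc)
  also have "\<dots> = x * p k x"
    by (simp add: wall_eq[of k ?N] sum_distrib_left mult_ac del: sum.atMost_Suc)
  finally show ?thesis ..
qed

section \<open>The masses at q^n and their moments\<close>

definition w :: "nat \<Rightarrow> real" where "w n = (\<alpha> * q) ^ n / qpoch q q n"

lemma w_pos: "w n > 0"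
  using q_pos \<alpha>_pos qpoch_q_pos by (simp add: w_def)

text \<open>The ratio of successive masses without division. It feeds both the ratio test and the
  step from one moment to the next.\<close>

lemma w_Suc: "w (Suc n) * (1 - q ^ Suc n) = \<alpha> * q * w n"
  using qpoch_q_pos[of n] q_power_Suc_less_1[of n] by (simp add: w_def qpoch_Suc field_simps)

lemma summable_w: "summable w"
proof -
  \<comment> \<open>The midpoint between 1 and \<open>\<alpha> * q\<close>, the limit of the ratios
    \<open>w (Suc n) / w n\<close>.\<close>
  define c where "c = (1 + \<alpha> * q) / 2"
  have c: "\<alpha> * q < c" "c < 1" "0 < c"
    using \<alpha>q_less_1 q_pos \<alpha>_pos by (auto simp: c_def field_simps add_pos_pos)
  have "(\<lambda>n. 1 - q ^ Suc n) \<longlonglongrightarrow> 1 - 0"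
    using q_pos q_less_1 by (intro tendsto_intros LIMSEQ_Suc LIMSEQ_realpow_zero) auto
  then have "eventually (\<lambda>n. 1 - q ^ Suc n > \<alpha> * q / c) sequentially"
    using c by (intro order_tendstoD) (auto simp: field_simps)
  then obtain N where N: "\<And>n. n \<ge> N \<Longrightarrow> \<alpha> * q / c < 1 - q ^ Suc n"
    by (auto simp: eventually_sequentially)
  show ?thesis
  proof (rule summable_ratio_test[OF c(2), of N])
    fix n assume "N \<le> n"
    from N[OF this] c have "\<alpha> * q \<le> c * (1 - q ^ Suc n)"
      by (simp add: field_simps)
    from mult_right_mono[OF this, of "w n"] have "\<alpha> * q * w n \<le> (c * w n) * (1 - q ^ Suc n)"
      using w_pos[of n] by (simp add: mult_ac)
    then have "w (Suc n) * (1 - q ^ Suc n) \<le> (c * w n) * (1 - q ^ Suc n)"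
      by (simp only: w_Suc)
    then have "w (Suc n) \<le> c * w n"
      using q_power_Suc_less_1[of n] by (simp add: mult_le_cancel_right)
    then show "norm (w (Suc n)) \<le> c * norm (w n)"
      using w_pos[of n] w_pos[of "Suc n"] by simp
  qed
qed

text \<open>By the q-binomial theorem this is the reciprocal of the infinite product of all
  \<open>1 - \<alpha> * q * q ^ r\<close>.\<close>

definition E :: real where "E = suminf w"

lemma E_pos: "E > 0"
  unfolding E_def using summable_w w_pos by (intro suminf_pos) auto

text \<open>By \<open>w_Suc\<close>, \<open>\<alpha> * q * q ^ j\<close> times the series of moment
  j is the series of \<open>w n * (1 - q ^ n) * (q ^ n) ^ j\<close> shifted by one, and its missing
  term at n = 0 is zero. Subtracting it from moment j leaves moment j + 1.\<close>

lemma w_moment: "(\<lambda>n. w n * (q ^ n) ^ j) sums (E * qpoch (\<alpha> * q) q j)"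
proof (induction j)
  case 0
  then show ?case using summable_sums[OF summable_w] by (simp add: E_def)
next
  case (Suc j)
  have "(\<lambda>n. \<alpha> * q * q ^ j * (w n * (q ^ n) ^ j)) sums (\<alpha> * q * q ^ j * (E * qpoch (\<alpha> * q) q j))"
    by (intro sums_mult Suc)
  also have "(\<lambda>n. \<alpha> * q * q ^ j * (w n * (q ^ n) ^ j)) = (\<lambda>n. w (Suc n) * (1 - q ^ Suc n) * (q ^ Suc n) ^ j)"
    unfolding w_Suc by (simp add: fun_eq_iff power_mult_distrib mult_ac)
  finally have "(\<lambda>n. w n * (1 - q ^ n) * (q ^ n) ^ j) sums (\<alpha> * q * q ^ j * (E * qpoch (\<alpha> * q) q j))"
    by (subst (asm) sums_Suc_iff) simp
  from sums_diff[OF Suc this] show ?case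
    by (simp add: qpoch_Suc algebra_simps)
qed

text \<open>An indefinite summation, by induction on m. At m = k the right-hand side contains the
  factor 1 - q^(1-k) q^(k-1) = 0, which is the case used for the means.\<close>

lemma qpoch_inverse_sum:
  assumes "k > 0"
  shows "(\<Sum>j\<le>m. qpoch (inverse (q ^ k)) q j * q ^ j / qpoch q q j) = qpoch (inverse (q ^ (k - 1))) q m / qpoch q q m"
proof (induction m)
  case (Suc m)
  have eq: "inverse (q ^ (k - 1)) = inverse (q ^ k) * q"
    using q_pos assms by (cases k) auto
  have nz: "1 - q * q ^ m \<noteq> 0" "qpoch q q m \<noteq> 0"
    using q_power_Suc_less_1[of m] qpoch_q_pos[of m] by auto
  show ?case
    using nz unfolding sum.atMost_Suc Suc.IH eq qpoch_Suc[of "inverse (q ^ k) * q"] qpoch_Suc[of q]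
      qpoch_Suc_shift[of "inverse (q ^ k)"]
    by (simp add: field_simps)
qed auto

text \<open>Orthogonality to the constants: the moments cancel
  \<open>qpoch (\<alpha> * q) q j\<close> in the denominator of \<open>wall_coeff\<close>, and the
  sum of \<open>qpoch_inverse_sum\<close> remains.\<close>

lemma wall_mean: "(\<lambda>n. w n * p k (q ^ n)) sums (if k = 0 then E else 0)"
proof -
  have "(\<lambda>n. \<Sum>j\<le>k. wall_coeff k j * (w n * (q ^ n) ^ j)) sums (\<Sum>j\<le>k. wall_coeff k j * (E * qpoch (\<alpha> * q) q j))"
    by (intro sums_sum sums_mult w_moment)
  also have "(\<lambda>n. \<Sum>j\<le>k. wall_coeff k j * (w n * (q ^ n) ^ j)) = (\<lambda>n. w n * p k (q ^ n))"
    by (simp add: wall_eq[of k k] sum_distrib_left mult_ac)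
  also have "(\<Sum>j\<le>k. wall_coeff k j * (E * qpoch (\<alpha> * q) q j)) =
      E * (\<Sum>j\<le>k. qpoch (inverse (q ^ k)) q j * q ^ j / qpoch q q j)"
    using qpoch_a_pos by (simp add: wall_coeff_def sum_distrib_left less_imp_neq[symmetric] field_simps)
  also have "\<dots> = (if k = 0 then E else 0)"
    using qpoch_inverse_sum[of k k] qpoch_inverse_eq_0[of "k - 1" k] by auto
  finally show ?thesis .
qed

section \<open>Normalised polynomials and their orthogonality\<close>

definition u :: "nat \<Rightarrow> real \<Rightarrow> real" where
  "u k x = sqrt (qpoch (\<alpha> * q) q k / (qpoch q q k * (\<alpha> * q) ^ k)) * p k x"

text \<open>The geometric mean of \<open>A k\<close> and \<open>C (Suc k)\<close>: the off-diagonal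
  entry, up to sign, of the symmetrised recurrence.\<close>

definition \<beta> :: "nat \<Rightarrow> real" where
  "\<beta> k = q ^ k * sqrt (\<alpha> * q * (1 - \<alpha> * q * q ^ k) * (1 - q ^ Suc k))"

lemma \<beta>_pos: "\<beta> k > 0"
  using q_pos \<alpha>_pos aq_power_less_1[of k] q_power_Suc_less_1[of k] by (simp add: \<beta>_def)

lemma u_0 [simp]: "u 0 x = 1"
  by (simp add: u_def)

lemma u_recurrence:
  "x * u k x = (A k + C k) * u k x - \<beta> k * u (Suc k) x - (case k of 0 \<Rightarrow> 0 | Suc m \<Rightarrow> \<beta> m * u m x)"
proof -
  define s where "s k = sqrt (qpoch (\<alpha> * q) q k / (qpoch q q k * (\<alpha> * q) ^ k))" for k
  define r where "r k = 1 - \<alpha> * q * q ^ k" for k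
  define t where "t k = 1 - q * q ^ k" for k
  have pos: "s k > 0" "r k > 0" "t k > 0" "\<alpha> * q > 0" for k
    using qpoch_a_pos[of k] qpoch_q_pos[of k] q_pos \<alpha>_pos aq_power_less_1[of k] q_power_Suc_less_1[of k]
    by (auto simp: s_def r_def t_def)
  have s_Suc: "s (Suc k) = s k * sqrt (r k) / (sqrt (t k) * sqrt (\<alpha> * q))" for k
  proof -
    have "s (Suc k) = sqrt ((qpoch (\<alpha> * q) q k / (qpoch q q k * (\<alpha> * q) ^ k)) * (r k / (t k * (\<alpha> * q))))"
      unfolding s_def qpoch_Suc r_def t_def by (simp add: mult_ac)
    then show ?thesis
      by (simp add: s_def real_sqrt_mult real_sqrt_divide)
  qed
  have \<beta>: "\<beta> k = q ^ k * (sqrt (\<alpha> * q) * sqrt (r k) * sqrt (t k))" for k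
    by (simp add: \<beta>_def r_def t_def real_sqrt_mult)
  \<comment> \<open>Facts 1 and 2 say that rescaling by s turns both \<open>A k\<close> and
    \<open>C (Suc k)\<close> into \<open>\<beta> k\<close>, which makes the recurrence
    symmetric.\<close>
  have 1: "\<beta> k * s (Suc k) = A k * s k" for k
  proof -
    have "\<beta> k * s (Suc k) = q ^ k * (sqrt (r k) * sqrt (r k)) * s k"
      unfolding \<beta> s_Suc using pos(2)[of k] pos(3)[of k] pos(4) q_pos \<alpha>_pos by (simp add: field_simps)
    then show ?thesis using pos(2)[of k] by (simp add: A_def r_def)
  qed
  have 2: "\<beta> m * s m = C (Suc m) * s (Suc m)" for m
  proof -
    have sq: "sqrt (\<alpha> * q) * sqrt (\<alpha> * q) = \<alpha> * q" "sqrt (t m) * sqrt (t m) = t m"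
      using pos(3)[of m] pos(4) by simp_all
    have "C (Suc m) * s (Suc m) = q ^ m * (\<alpha> * q) * t m * (s m * sqrt (r m) / (sqrt (t m) * sqrt (\<alpha> * q)))"
      unfolding s_Suc by (simp add: C_def t_def)
    also have "\<dots> = q ^ m * (sqrt (\<alpha> * q) * sqrt (\<alpha> * q)) * (sqrt (t m) * sqrt (t m)) * (s m * sqrt (r m) / (sqrt (t m) * sqrt (\<alpha> * q)))"
      unfolding sq ..
    also have "\<dots> = \<beta> m * s m"
      unfolding \<beta> using pos(3)[of m] q_pos \<alpha>_pos by (simp add: field_simps)
    finally show ?thesis ..
  qed
  have u: "u k x = s k * p k x" for k
    by (simp add: u_def s_def)
  have "(case k of 0 \<Rightarrow> 0 | Suc m \<Rightarrow> \<beta> m * u m x) = C k * s k * p (k - 1) x"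
    using 2 by (auto simp: u C_def mult.assoc[symmetric] split: nat.split)
  moreover have "\<beta> k * u (Suc k) x = A k * s k * p (Suc k) x"
    by (simp add: u 1 mult.assoc[symmetric])
  moreover have "x * u k x = (A k + C k) * u k x - A k * s k * p (Suc k) x - C k * s k * p (k - 1) x"
    using arg_cong[OF wall_recurrence[of x k], of "\<lambda>y. s k * y"] by (simp add: u algebra_simps)
  ultimately show ?thesis
    by (simp only:)
qed

text \<open>The points q^n lie in the interval from 0 to 1, where a polynomial is bounded by the sum
  of the absolute values of its coefficients. The bound may depend on k; it only serves the
  convergence of the series of products.\<close>

lemma u_bounded: "\<exists>B. \<forall>n. \<bar>u k (q ^ n)\<bar> \<le> B"
proof (intro exI allI)
  fix n :: nat
  have "\<bar>p k (q ^ n)\<bar> \<le> (\<Sum>j\<le>k. \<bar>wall_coeff k j * (q ^ n) ^ j\<bar>)"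
    by (simp only: wall_eq[of k k, OF order_refl] sum_abs)
  also have "\<dots> \<le> (\<Sum>j\<le>k. \<bar>wall_coeff k j\<bar>)"
    using q_pos q_less_1
    by (intro sum_mono) (simp add: abs_mult mult_left_le power_le_one)
  finally show "\<bar>u k (q ^ n)\<bar> \<le> \<bar>sqrt (qpoch (\<alpha> * q) q k / (qpoch q q k * (\<alpha> * q) ^ k))\<bar> * (\<Sum>j\<le>k. \<bar>wall_coeff k j\<bar>)"
    unfolding u_def abs_mult by (rule mult_left_mono) simp
qed

lemma summable_u_u: "summable (\<lambda>n. w n * (u j (q ^ n) * u k (q ^ n)))"
proof -
  obtain B1 B2 where B: "\<bar>u j (q ^ n)\<bar> \<le> B1" "\<bar>u k (q ^ n)\<bar> \<le> B2" for n
    using u_bounded by meson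
  show ?thesis
  proof (rule summable_comparison_test'[OF summable_mult[OF summable_w, of "B1 * B2"]])
    fix n :: nat
    have "\<bar>u j (q ^ n)\<bar> * \<bar>u k (q ^ n)\<bar> \<le> B1 * B2"
      using B[of n] by (intro mult_mono) auto
    then show "norm (w n * (u j (q ^ n) * u k (q ^ n))) \<le> B1 * B2 * w n"
      using w_pos[of n] by (simp add: abs_mult mult.commute[of "w n"] mult_right_mono)
  qed
qed

text \<open>
  Multiplication by the variable is symmetric, so the recurrence can be moved from one factor to the
  other; this determines all products from the means of the \<^term>\<open>u k\<close>.
\<close>
lemma u_orthonormal: "(\<lambda>n. w n * (u j (q ^ n) * u k (q ^ n))) sums (if j = k then E else 0)"
proof -
  define M where "M j k = (\<Sum>n. w n * (u j (q ^ n) * u k (q ^ n)))" for j k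
  \<comment> \<open>The contribution of the lower neighbour in the recurrence, absent at index
    0.\<close>
  define Q where "Q = (\<lambda>j k. case k of 0 \<Rightarrow> 0 | Suc m \<Rightarrow> \<beta> m * M j m)"
  have M: "(\<lambda>n. w n * (u j (q ^ n) * u k (q ^ n))) sums M j k" for j k
    unfolding M_def by (rule summable_sums[OF summable_u_u])
  have M_sym: "M j k = M k j" for j k
    by (simp add: M_def mult.commute)
  have shift: "(\<lambda>n. w n * (u j (q ^ n) * (q ^ n * u k (q ^ n)))) sums
      ((A k + C k) * M j k - \<beta> k * M j (Suc k) - Q j k)" for j k
  proof -
    have "(\<lambda>n. case k of 0 \<Rightarrow> 0 | Suc m \<Rightarrow> \<beta> m * (w n * (u j (q ^ n) * u m (q ^ n)))) sums Q j k"
      by (cases k) (auto simp: Q_def intro!: sums_mult M)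
    then have "(\<lambda>n. (A k + C k) * (w n * (u j (q ^ n) * u k (q ^ n))) - \<beta> k * (w n * (u j (q ^ n) * u (Suc k) (q ^ n)))
        - (case k of 0 \<Rightarrow> 0 | Suc m \<Rightarrow> \<beta> m * (w n * (u j (q ^ n) * u m (q ^ n))))) sums
        ((A k + C k) * M j k - \<beta> k * M j (Suc k) - Q j k)"
      by (intro sums_diff sums_mult M)
    moreover have "w n * (u j (q ^ n) * (q ^ n * u k (q ^ n))) =
        (A k + C k) * (w n * (u j (q ^ n) * u k (q ^ n))) - \<beta> k * (w n * (u j (q ^ n) * u (Suc k) (q ^ n)))
        - (case k of 0 \<Rightarrow> 0 | Suc m \<Rightarrow> \<beta> m * (w n * (u j (q ^ n) * u m (q ^ n))))" for n
      unfolding u_recurrence[of _ k] by (cases k) (simp_all add: algebra_simps)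
    ultimately show ?thesis by simp
  qed
  \<comment> \<open>The mean of x u_j(x) u_k(x) is computed twice, applying the recurrence to either
    factor.\<close>
  have sym: "(A k + C k) * M j k - \<beta> k * M j (Suc k) - Q j k = (A j + C j) * M j k - \<beta> j * M (Suc j) k - Q k j" for j k
  proof -
    have "(\<lambda>n. w n * (u j (q ^ n) * (q ^ n * u k (q ^ n)))) = (\<lambda>n. w n * (u k (q ^ n) * (q ^ n * u j (q ^ n))))"
      by (simp add: mult_ac)
    from sums_unique2[OF shift[of j k, unfolded this] shift[of k j]] show ?thesis
      by (simp add: M_sym)
  qed
  \<comment> \<open>Row 0 consists of the means. For j = i + 1, \<open>sym\<close> expresses
    \<open>\<beta> i * M (Suc i) k\<close> through rows i and i - 1, and \<beta> is positive; the
    two earlier rows are the reason for strong induction.\<close>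
  have "(\<forall>k. M j k = (if j = k then E else 0))" for j
  proof (induction j rule: less_induct)
    case (less j)
    show ?case
    proof (cases j)
      case 0
      have "(\<lambda>n. w n * u k (q ^ n)) sums (if k = 0 then E else 0)" for k
        using sums_mult[OF wall_mean[of k], of "sqrt (qpoch (\<alpha> * q) q k / (qpoch q q k * (\<alpha> * q) ^ k))"]
        by (cases "k = 0") (simp_all add: u_def mult_ac)
      then have "M 0 k = (if k = 0 then E else 0)" for k
        using M[of 0 k] by (simp add: sums_unique2)
      then show ?thesis using 0 by auto
    next
      case (Suc i)
      have IH: "M i k = (if i = k then E else 0)" for k
        using less[of i] Suc by auto
      have IH': "M k m = (if m = k then E else 0)" if "i = Suc m" for m k
        using less[of m] Suc that by (simp add: M_sym[of k m])
      show ?thesis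
      proof
        fix k
        have "\<beta> i * M (Suc i) k = (A i + C i - (A k + C k)) * M i k + \<beta> k * M i (Suc k) + Q i k - Q k i"
          using sym[of k i] by (simp add: algebra_simps)
        also have "\<dots> = \<beta> i * (if Suc i = k then E else 0)"
        proof -
          have "Q i k = (case k of 0 \<Rightarrow> 0 | Suc m \<Rightarrow> if i = m then \<beta> m * E else 0)"
            by (simp add: Q_def IH split: nat.split)
          moreover have "Q k i = (case i of 0 \<Rightarrow> 0 | Suc m \<Rightarrow> if m = k then \<beta> m * E else 0)"
            using IH' by (auto simp: Q_def split: nat.split)
          ultimately show ?thesis
            by (auto simp: IH split: nat.split)
        qed
        finally show "M j k = (if j = k then E else 0)"
          using \<beta>_pos[of i] Suc by (simp del: of_nat_Suc)
      qed
    qed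
  qed
  then show ?thesis using M[of j k] by simp
qed

text \<open>Bessel's inequality for the system \<^term>\<open>\<lambda>k n. u k (q ^ n)\<close> and the unit mass at n.\<close>
lemma sum_u_squared_le: "(\<Sum>k<K. (u k (q ^ n))\<^sup>2) \<le> E / w n"
proof -
  define S where "S = (\<Sum>k<K. (u k (q ^ n))\<^sup>2)"
  \<comment> \<open>Up to the factor \<open>w n / E\<close>, g is the projection of the indicator
    function of the point q^n onto the first K polynomials.\<close>
  define g where "g m = (\<Sum>k<K. u k (q ^ n) * u k (q ^ m))" for m
  have "(\<lambda>m. \<Sum>j<K. \<Sum>k<K. u j (q ^ n) * u k (q ^ n) * (w m * (u j (q ^ m) * u k (q ^ m)))) sums
      (\<Sum>j<K. \<Sum>k<K. u j (q ^ n) * u k (q ^ n) * (if j = k then E else 0))"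
    by (intro sums_sum sums_mult u_orthonormal)
  also have "(\<lambda>m. \<Sum>j<K. \<Sum>k<K. u j (q ^ n) * u k (q ^ n) * (w m * (u j (q ^ m) * u k (q ^ m)))) = (\<lambda>m. w m * (g m)\<^sup>2)"
    by (simp add: g_def power2_eq_square sum_product sum_distrib_left mult_ac)
  also have "(\<Sum>j<K. \<Sum>k<K. u j (q ^ n) * u k (q ^ n) * (if j = k then E else 0)) = E * S"
    by (simp add: S_def if_distrib[of "\<lambda>x. _ * x"] sum_distrib_left power2_eq_square mult_ac cong: if_cong)
  finally have sums: "(\<lambda>m. w m * (g m)\<^sup>2) sums (E * S)" .
  \<comment> \<open>Only the term m = n of the series is kept. As \<open>g n = S\<close>, this
    yields w_n S^2 <= E S.\<close>
  have "(\<Sum>m\<in>{n}. w m * (g m)\<^sup>2) \<le> E * S"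
    using sums w_pos by (intro sum_le_suminf[THEN order_trans, of "\<lambda>m. w m * (g m)\<^sup>2"])
      (auto simp: sums_iff less_imp_le)
  moreover have "g n = S"
    by (simp add: g_def S_def power2_eq_square)
  ultimately have "w n * S * S \<le> E * S"
    by (simp add: power2_eq_square mult_ac)
  moreover have "S \<ge> 0" by (simp add: S_def sum_nonneg)
  ultimately have "w n * S \<le> E"
    using E_pos w_pos[of n] by (cases "S = 0") auto
  then show ?thesis using w_pos[of n] by (simp add: S_def field_simps)
qed

end

section \<open>The Hilbert space\<close>

locale discrete_series =
  fixes q l :: real
  assumes q_pos: "0 < q" and q_less_1: "q < 1" and l_pos: "0 < l"
begin

abbreviation (input) co :: "complex fps \<Rightarrow> nat \<Rightarrow> complex" where "co \<equiv> f_coord q l"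
abbreviation (input) \<H> :: "complex fps set" where "\<H> \<equiv> hl_space q l"
abbreviation (input) ip :: "complex fps \<Rightarrow> complex fps \<Rightarrow> complex" where "ip \<equiv> hl_inner q l"
abbreviation (input) nm :: "complex fps \<Rightarrow> real" where "nm \<equiv> hl_norm q l"

lemmas coord_series = f_coord_series[OF q_pos q_less_1 l_pos]
lemmas coord_basis = f_coord_basis[OF q_pos q_less_1 l_pos]
lemmas coord_eqI = fps_eq_f_coordI[OF q_pos q_less_1 l_pos]
lemmas basis_in = f_basis_orthonormal(1)[OF q_pos q_less_1 l_pos]

lemma coord_0 [simp]: "co 0 n = 0"
  by (simp add: f_coord_def)

lemma coord_add [simp]: "co (F + G) n = co F n + co G n"
  by (simp add: f_coord_def add_divide_distrib)

lemma coord_diff [simp]: "co (F - G) n = co F n - co G n"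
  by (simp add: f_coord_def diff_divide_distrib)

declare f_coord_cscale [simp]

lemma coord_sum: "co (\<Sum>i\<in>I. F i) n = (\<Sum>i\<in>I. co (F i) n)"
  by (induction I rule: infinite_finite_induct) auto

lemma summable_inner:
  assumes "F \<in> \<H>" "G \<in> \<H>"
  shows "summable (\<lambda>n. co F n * cnj (co G n))"
proof (rule summable_comparison_test')
  show "summable (\<lambda>n. (cmod (co F n))\<^sup>2 + (cmod (co G n))\<^sup>2)"
    using assms by (intro summable_add) (auto simp: hl_space_def)
  fix n
  show "norm (co F n * cnj (co G n)) \<le> (cmod (co F n))\<^sup>2 + (cmod (co G n))\<^sup>2"
    using sum_squares_bound[of "cmod (co F n)" "cmod (co G n)", unfolded mult.assoc]
      mult_nonneg_nonneg[OF norm_ge_zero norm_ge_zero, of "co F n" "co G n"]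
    unfolding norm_mult complex_mod_cnj by linarith
qed

lemma subspace_H: "cfps.subspace \<H>"
proof (rule cfps.subspaceI)
  fix F G assume "F \<in> \<H>" "G \<in> \<H>"
  then have "summable (\<lambda>n. 2 * ((cmod (co F n))\<^sup>2 + (cmod (co G n))\<^sup>2))"
    by (intro summable_mult summable_add) (auto simp: hl_space_def)
  moreover have "(cmod (co F n + co G n))\<^sup>2 \<le> 2 * ((cmod (co F n))\<^sup>2 + (cmod (co G n))\<^sup>2)" for n
  proof -
    have "(cmod (co F n + co G n))\<^sup>2 \<le> (cmod (co F n) + cmod (co G n))\<^sup>2"
      by (intro power_mono norm_triangle_ineq) auto
    also have "\<dots> \<le> 2 * ((cmod (co F n))\<^sup>2 + (cmod (co G n))\<^sup>2)"
      using sum_squares_bound[of "cmod (co F n)" "cmod (co G n)"] by (simp add: power2_sum)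
    finally show ?thesis .
  qed
  ultimately show "F + G \<in> \<H>"
    unfolding hl_space_def by (auto intro: summable_comparison_test')
next
  fix c F assume "F \<in> \<H>"
  then show "cscale c F \<in> \<H>"
    by (auto simp: hl_space_def norm_mult power_mult_distrib intro: summable_mult)
qed (simp add: hl_space_def)

lemmas add_in = cfps.subspace_add[OF subspace_H]
  and diff_in = cfps.subspace_diff[OF subspace_H]
  and cscale_in = cfps.subspace_scale[OF subspace_H]
  and sum_in = cfps.subspace_sum[OF subspace_H]

section \<open>Inner product and norm\<close>

lemma ip_add_left: "F \<in> \<H> \<Longrightarrow> G \<in> \<H> \<Longrightarrow> K \<in> \<H> \<Longrightarrow> ip (F + G) K = ip F K + ip G K"
  by (simp add: hl_inner_def distrib_right suminf_add summable_inner)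

lemma ip_diff_left: "F \<in> \<H> \<Longrightarrow> G \<in> \<H> \<Longrightarrow> K \<in> \<H> \<Longrightarrow> ip (F - G) K = ip F K - ip G K"
  by (simp add: hl_inner_def left_diff_distrib suminf_diff summable_inner)

lemma ip_cscale_left: "F \<in> \<H> \<Longrightarrow> K \<in> \<H> \<Longrightarrow> ip (cscale c F) K = c * ip F K"
  by (simp add: hl_inner_def mult.assoc suminf_mult summable_inner)

lemma ip_commute: "F \<in> \<H> \<Longrightarrow> G \<in> \<H> \<Longrightarrow> ip G F = cnj (ip F G)"
  using bounded_linear.suminf[OF bounded_linear_cnj summable_inner[of F G]]
  by (simp add: hl_inner_def mult.commute)

lemma ip_add_right: "F \<in> \<H> \<Longrightarrow> G \<in> \<H> \<Longrightarrow> K \<in> \<H> \<Longrightarrow> ip K (F + G) = ip K F + ip K G"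
  by (simp add: ip_commute[of _ K] ip_add_left add_in)

lemma ip_diff_right: "F \<in> \<H> \<Longrightarrow> G \<in> \<H> \<Longrightarrow> K \<in> \<H> \<Longrightarrow> ip K (F - G) = ip K F - ip K G"
  by (simp add: ip_commute[of _ K] ip_diff_left diff_in)

lemma ip_cscale_right: "F \<in> \<H> \<Longrightarrow> K \<in> \<H> \<Longrightarrow> ip K (cscale c F) = cnj c * ip K F"
  by (simp add: ip_commute[of _ K] ip_cscale_left cscale_in)

lemma ip_zero_right [simp]: "ip F 0 = 0"
  by (simp add: hl_inner_def)

lemma ip_sum_right: "(\<And>i. i \<in> I \<Longrightarrow> F i \<in> \<H>) \<Longrightarrow> K \<in> \<H> \<Longrightarrow> ip K (\<Sum>i\<in>I. F i) = (\<Sum>i\<in>I. ip K (F i))"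
  by (induction I rule: infinite_finite_induct) (auto simp: ip_add_right sum_in)

lemma ip_self:
  assumes "F \<in> \<H>"
  shows "ip F F = of_real (\<Sum>n. (cmod (co F n))\<^sup>2)"
  using assms unfolding hl_inner_def complex_norm_square[symmetric]
  by (simp add: hl_space_def suminf_of_real)

lemma nm_squared: "F \<in> \<H> \<Longrightarrow> (nm F)\<^sup>2 = (\<Sum>n. (cmod (co F n))\<^sup>2)"
  by (simp add: hl_norm_def ip_self hl_space_def suminf_nonneg)

lemma ip_self_nm: "F \<in> \<H> \<Longrightarrow> ip F F = of_real ((nm F)\<^sup>2)"
  by (simp only: ip_self nm_squared)

lemma nm_nonneg: "F \<in> \<H> \<Longrightarrow> nm F \<ge> 0"
  by (simp add: hl_norm_def ip_self hl_space_def suminf_nonneg)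

lemma nm_eq_0:
  assumes "F \<in> \<H>" "nm F = 0"
  shows "F = 0"
proof (rule coord_eqI)
  fix n
  have "(\<Sum>n. (cmod (co F n))\<^sup>2) = 0"
    using assms nm_squared[of F] by simp
  then have "(cmod (co F n))\<^sup>2 = 0"
    using assms by (subst (asm) suminf_eq_zero_iff) (auto simp: hl_space_def)
  then show "co F n = co 0 n" by simp
qed

lemma nm_diff_squared:
  assumes "F \<in> \<H>" "G \<in> \<H>"
  shows "(nm (F - G))\<^sup>2 = (nm F)\<^sup>2 - 2 * Re (ip F G) + (nm G)\<^sup>2"
proof -
  have "complex_of_real ((nm (F - G))\<^sup>2) = ip F F - ip F G - (cnj (ip F G) - ip G G)"
    using assms by (simp add: ip_self_nm[symmetric] diff_in ip_diff_left ip_diff_right ip_commute[of F G] del: of_real_power)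
  then have "Re (complex_of_real ((nm (F - G))\<^sup>2)) = Re (ip F F - ip F G - (cnj (ip F G) - ip G G))"
    by simp
  then show ?thesis using assms by (simp add: ip_self_nm del: of_real_power)
qed

lemma nm_cscale: "F \<in> \<H> \<Longrightarrow> nm (cscale c F) = cmod c * nm F"
proof -
  assume F: "F \<in> \<H>"
  have "(nm (cscale c F))\<^sup>2 = (cmod c * nm F)\<^sup>2"
    using F by (simp add: nm_squared cscale_in norm_mult power_mult_distrib suminf_mult hl_space_def)
  then show ?thesis
    using F by (simp add: nm_nonneg cscale_in power2_eq_iff_nonneg)
qed

lemma cauchy_schwarz:
  assumes "F \<in> \<H>" "G \<in> \<H>"
  shows "cmod (ip F G) \<le> nm F * nm G"
proof (cases "nm G = 0")
  case True
  then have "G = 0" using assms nm_eq_0 by auto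
  then show ?thesis using assms nm_nonneg True by simp
next
  case False
  then have pos: "nm G > 0" using nm_nonneg[OF assms(2)] by simp
  \<comment> \<open>With this t the vector \<open>cscale t G\<close> is the orthogonal projection of
    F onto the line of G; expanding the squared norm of the remainder gives the inequality.\<close>
  define t where "t = ip F G / of_real ((nm G)\<^sup>2)"
  have "Re (cnj t * ip F G) = (cmod (ip F G))\<^sup>2 / (nm G)\<^sup>2"
  proof -
    have "cnj t * ip F G = (ip F G * cnj (ip F G)) / of_real ((nm G)\<^sup>2)"
      by (simp add: t_def mult.commute)
    also have "\<dots> = of_real ((cmod (ip F G))\<^sup>2 / (nm G)\<^sup>2)"
      by (simp only: complex_norm_square[symmetric] of_real_divide)
    finally show ?thesis by (simp only: Re_complex_of_real)
  qed
  moreover have "cmod t = cmod (ip F G) / (nm G)\<^sup>2"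
    by (simp add: t_def norm_divide norm_power)
  then have "(nm (cscale t G))\<^sup>2 = (cmod (ip F G))\<^sup>2 / (nm G)\<^sup>2"
    using assms pos by (simp add: nm_cscale field_simps power2_eq_square)
  moreover have "0 \<le> (nm (F - cscale t G))\<^sup>2" by simp
  ultimately have "(cmod (ip F G))\<^sup>2 / (nm G)\<^sup>2 \<le> (nm F)\<^sup>2"
    using assms by (simp add: nm_diff_squared cscale_in ip_cscale_right)
  then have "(cmod (ip F G))\<^sup>2 \<le> (nm F * nm G)\<^sup>2"
    using pos by (simp add: field_simps power_mult_distrib)
  then show ?thesis
    by (rule power2_le_imp_le) (use assms nm_nonneg in auto)
qed

lemma nm_minus_commute: "nm (F - G) = nm (G - F)"
proof -
  have "co (F - G) n * cnj (co (F - G) n) = co (G - F) n * cnj (co (G - F) n)" for n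
    by (simp add: algebra_simps)
  then show ?thesis unfolding hl_norm_def hl_inner_def by presburger
qed

lemma nm_triangle:
  assumes "F \<in> \<H>" "G \<in> \<H>"
  shows "nm (F + G) \<le> nm F + nm G"
proof -
  \<comment> \<open>Obtained from the formula for differences by writing F + G as F - (-1)
    G.\<close>
  have "(nm (F + G))\<^sup>2 = (nm F)\<^sup>2 + 2 * Re (ip F G) + (nm G)\<^sup>2"
    using nm_diff_squared[OF assms(1) cscale_in[OF assms(2), of "- 1"]]
      nm_cscale[OF assms(2), of "- 1"] ip_cscale_right[OF assms(2,1), of "- 1"] by simp
  moreover have "Re (ip F G) \<le> nm F * nm G"
    using complex_Re_le_cmod cauchy_schwarz[OF assms] by (rule order_trans)
  ultimately have "(nm (F + G))\<^sup>2 \<le> (nm F + nm G)\<^sup>2"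
    by (simp add: power2_sum)
  then show ?thesis
    by (rule power2_le_imp_le) (use assms nm_nonneg in auto)
qed

text \<open>Pythagoras: all mixed terms of the expanded inner product vanish.\<close>

lemma nm_sum_squared:
  assumes "finite I" "\<And>i. i \<in> I \<Longrightarrow> F i \<in> \<H>"
    "\<And>i j. i \<in> I \<Longrightarrow> j \<in> I \<Longrightarrow> i \<noteq> j \<Longrightarrow> ip (F i) (F j) = 0"
  shows "(nm (\<Sum>i\<in>I. F i))\<^sup>2 = (\<Sum>i\<in>I. (nm (F i))\<^sup>2)"
proof -
  have "complex_of_real ((nm (\<Sum>i\<in>I. F i))\<^sup>2) = (\<Sum>j\<in>I. ip (\<Sum>i\<in>I. F i) (F j))"
    using assms by (simp add: ip_self_nm[symmetric] sum_in ip_sum_right del: of_real_power)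
  also have "\<dots> = (\<Sum>j\<in>I. ip (F j) (F j))"
  proof (rule sum.cong)
    fix j assume j: "j \<in> I"
    have "ip (F j) (\<Sum>i\<in>I. F i) = (\<Sum>i\<in>I. ip (F j) (F i))"
      using assms j by (intro ip_sum_right) auto
    also have "\<dots> = (\<Sum>i\<in>I. if i = j then ip (F j) (F j) else 0)"
      using assms j by (intro sum.cong) auto
    finally have "ip (F j) (\<Sum>i\<in>I. F i) = ip (F j) (F j)"
      using assms(1) j by simp
    then show "ip (\<Sum>i\<in>I. F i) (F j) = ip (F j) (F j)"
      using assms j by (metis ip_commute sum_in)
  qed simp
  also have "\<dots> = of_real (\<Sum>i\<in>I. (nm (F i))\<^sup>2)"
    unfolding of_real_sum using assms by (intro sum.cong) (auto simp: ip_self_nm)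
  finally show ?thesis by (simp only: of_real_eq_iff)
qed

section \<open>Basis expansions and density\<close>

lemma nm_basis: "nm (f_basis q l j) = 1"
  using f_basis_orthonormal(2)[OF q_pos q_less_1 l_pos, of j j] by (simp add: hl_norm_def)

lemma ip_basis_left: "ip (f_basis q l j) F = cnj (co F j)"
proof -
  have "(\<lambda>n. co (f_basis q l j) n * cnj (co F n)) = (\<lambda>n. if n = j then cnj (co F j) else 0)"
    by (auto simp: coord_basis)
  then show ?thesis
    using sums_single[of j "\<lambda>_. cnj (co F j)"] by (simp add: hl_inner_def sums_iff)
qed

text \<open>The squared norm of the remainder is a tail of the convergent series of squared
  coordinates.\<close>

lemma hl_sums_basis:
  assumes F: "F \<in> \<H>"
  shows "hl_sums q l (\<lambda>k. cscale (co F k) (f_basis q l k)) F"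
proof -
  define R where "R N = (\<Sum>k<N. cscale (co F k) (f_basis q l k)) - F" for N
  define S where "S = (\<Sum>n. (cmod (co F n))\<^sup>2)"
  have sums: "(\<lambda>n. (cmod (co F n))\<^sup>2) sums S"
    using F by (auto simp: S_def hl_space_def)
  have R_in: "R N \<in> \<H>" for N
    using F by (simp add: R_def diff_in sum_in cscale_in basis_in)
  have "(nm (R N))\<^sup>2 = S - (\<Sum>n<N. (cmod (co F n))\<^sup>2)" for N
  proof -
    have "(cmod (co (R N) n))\<^sup>2 = (cmod (co F n))\<^sup>2 - (if n \<in> {..<N} then (cmod (co F n))\<^sup>2 else 0)" for n
      by (simp add: R_def coord_sum coord_basis if_distrib[of "\<lambda>x. _ * x"] cong: if_cong)
    moreover have "(\<lambda>n. (cmod (co F n))\<^sup>2 - (if n \<in> {..<N} then (cmod (co F n))\<^sup>2 else 0)) sums (S - (\<Sum>n<N. (cmod (co F n))\<^sup>2))"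
      by (intro sums_diff sums sums_If_finite_set) simp
    ultimately show ?thesis by (simp add: nm_squared[OF R_in] sums_iff)
  qed
  moreover have "(\<lambda>N. S - (\<Sum>n<N. (cmod (co F n))\<^sup>2)) \<longlonglongrightarrow> S - S"
    using sums by (intro tendsto_intros) (simp add: sums_def)
  ultimately have "(\<lambda>N. sqrt ((nm (R N))\<^sup>2)) \<longlonglongrightarrow> sqrt 0"
    by (intro tendsto_real_sqrt) simp
  then show ?thesis
    using F nm_nonneg[OF R_in] by (simp add: hl_sums_def R_def[symmetric] cscale_in basis_in)
qed

text \<open>The vectors approximable from the span form a subspace (\<open>appr\<close>). Once it
  contains the basis it contains all finite basis sums, and these approximate every vector by
  \<open>hl_sums_basis\<close>.\<close>

lemma dense_spanI:
  assumes S: "S \<subseteq> \<H>"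
    and basis: "\<And>j e. e > 0 \<Longrightarrow> \<exists>G\<in>cfps.span S. nm (f_basis q l j - G) < e"
  shows "hl_dense_span q l S"
proof -
  have span: "G \<in> \<H>" if "G \<in> cfps.span S" for G
    using cfps.span_minimal[OF S subspace_H] that by auto
  define appr where "appr F \<longleftrightarrow> F \<in> \<H> \<and> (\<forall>e>0. \<exists>G\<in>cfps.span S. nm (F - G) < e)" for F
  have add: "appr (F + F')" if "appr F" "appr F'" for F F'
    unfolding appr_def
  proof (intro conjI allI impI)
    show "F + F' \<in> \<H>" using that by (simp add: appr_def add_in)
    fix e :: real assume "e > 0"
    then have "e / 2 > 0" by simp
    then obtain G G' where G: "G \<in> cfps.span S" "nm (F - G) < e / 2" "G' \<in> cfps.span S" "nm (F' - G') < e / 2"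
      using \<open>appr F\<close> \<open>appr F'\<close> unfolding appr_def by meson
    have "nm ((F - G) + (F' - G')) \<le> nm (F - G) + nm (F' - G')"
      using that G by (intro nm_triangle diff_in) (auto simp: appr_def span)
    then have "nm ((F + F') - (G + G')) < e"
      using G by (simp add: algebra_simps)
    then show "\<exists>G\<in>cfps.span S. nm (F + F' - G) < e"
      using G cfps.span_add by blast
  qed
  have scale: "appr (cscale c F)" if "appr F" for c F
    unfolding appr_def
  proof (intro conjI allI impI)
    show "cscale c F \<in> \<H>" using that by (simp add: appr_def cscale_in)
    fix e :: real assume "e > 0"
    \<comment> \<open>The added 1 covers c = 0.\<close>
    then have "e / (cmod c + 1) > 0" by (smt (verit) divide_pos_pos norm_ge_zero)
    then obtain G where G: "G \<in> cfps.span S" "nm (F - G) < e / (cmod c + 1)"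
      using \<open>appr F\<close> by (auto simp: appr_def)
    have FG: "F - G \<in> \<H>" using that G by (auto simp: appr_def intro: diff_in span)
    have "nm (cscale c F - cscale c G) = cmod c * nm (F - G)"
      using nm_cscale[OF FG] by (simp add: cfps.scale_right_diff_distrib)
    also have "\<dots> \<le> (cmod c + 1) * nm (F - G)"
      using nm_nonneg[OF FG] by (intro mult_right_mono) auto
    also have "\<dots> < e"
      using G(2) by (simp add: field_simps add_pos_nonneg pos_less_divide_eq)
    finally show "\<exists>G\<in>cfps.span S. nm (cscale c F - G) < e"
      using G(1) cfps.span_scale by blast
  qed
  have zero: "appr 0"
    using cfps.subspace_0[OF subspace_H] cfps.span_zero[of S] by (force simp: appr_def hl_norm_def)
  have sum: "appr (\<Sum>k<N. cscale (c k) (f_basis q l k))" for c and N :: nat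
    by (induction N) (auto intro!: add scale zero simp: appr_def[of "f_basis _ _ _"] basis basis_in)
  show ?thesis unfolding hl_dense_span_def
  proof (intro ballI allI impI)
    fix F e assume F: "F \<in> \<H>" and e: "(e::real) > 0"
    let ?T = "\<lambda>N. \<Sum>k<N. cscale (co F k) (f_basis q l k)"
    have "(\<lambda>N. nm (?T N - F)) \<longlonglongrightarrow> 0"
      using hl_sums_basis[OF F] by (simp add: hl_sums_def)
    then have "eventually (\<lambda>N. nm (?T N - F) < e / 2) sequentially"
      using e by (intro order_tendstoD) auto
    then obtain N where N: "nm (?T N - F) < e / 2"
      by (auto simp: eventually_sequentially)
    obtain G where G: "G \<in> cfps.span S" "nm (?T N - G) < e / 2"
      using sum[of "co F" N] e unfolding appr_def by (meson half_gt_zero)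
    have "nm ((F - ?T N) + (?T N - G)) \<le> nm (F - ?T N) + nm (?T N - G)"
      using F G sum by (intro nm_triangle diff_in) (auto simp: span appr_def)
    then have "nm (F - G) < e"
      using N G by (simp add: nm_minus_commute[of F])
    then show "\<exists>G\<in>cfps.span S. nm (F - G) < e" using G by blast
  qed
qed

text \<open>If F were nonzero, some G in the span would be closer to F than \<open>nm F\<close>. As
  F is orthogonal to G, (nm F)^2 is the modulus of the inner product of F with F - G, and
  Cauchy-Schwarz makes it smaller than itself.\<close>

lemma orthogonal_to_dense_eq_0:
  assumes S: "S \<subseteq> \<H>" and dense: "hl_dense_span q l S" and F: "F \<in> \<H>"
    and orth: "\<And>G. G \<in> S \<Longrightarrow> ip F G = 0"
  shows "F = 0"
proof (rule ccontr)
  assume "F \<noteq> 0"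
  then have pos: "nm F > 0"
    using nm_eq_0[OF F] nm_nonneg[OF F] by fastforce
  have "cfps.subspace {G \<in> \<H>. ip F G = 0}"
    using F by (intro cfps.subspaceI)
      (auto simp: ip_add_right ip_cscale_right add_in cscale_in cfps.subspace_0[OF subspace_H])
  then have span: "G \<in> \<H> \<and> ip F G = 0" if "G \<in> cfps.span S" for G
    using cfps.span_minimal[of S "{G \<in> \<H>. ip F G = 0}"] S orth that by auto
  obtain G where G: "G \<in> cfps.span S" "nm (F - G) < nm F"
    using dense F pos by (auto simp: hl_dense_span_def)
  have "(nm F)\<^sup>2 = cmod (ip F F)"
    using F by (simp add: ip_self_nm norm_power)
  also have "ip F F = ip F (F - G)"
    using span[OF G(1)] F by (simp add: ip_diff_right)
  also have "cmod \<dots> \<le> nm F * nm (F - G)"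
    using span[OF G(1)] F by (intro cauchy_schwarz diff_in) auto
  also have "\<dots> < nm F * nm F"
    using G(2) pos by simp
  finally show False by (simp add: power2_eq_square)
qed

end

section \<open>The operator and its eigenvectors\<close>

text \<open>The raising part of a Jacobi matrix has nothing in row 0; this removes that zero when
  its series is compared with a lowering part.\<close>

lemma sums_case_nat_shift:
  fixes f :: "nat \<Rightarrow> 'a :: real_normed_vector"
  shows "(\<lambda>n. case n of 0 \<Rightarrow> 0 | Suc m \<Rightarrow> f m) sums s \<longleftrightarrow> f sums s"
  using sums_Suc_iff[of "\<lambda>n. case n of 0 \<Rightarrow> 0 | Suc m \<Rightarrow> f m" s] by simp

text \<open>Splits off a power of q, so that the factors 1 - q^c match those of the q-shifted
  factorials.\<close>

lemma qnum_eq: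
  assumes "0 < q"
  shows "qnum q c = q powr ((1 - c) / 2) * (1 - q powr c) / (1 - q)"
proof -
  have num: "q powr (c / 2) - q powr (- c / 2) = - (q powr (- c / 2) * (1 - q powr c))" for c
  proof -
    have "q powr (- c / 2) * q powr c = q powr (c / 2)"
      by (simp add: powr_add[symmetric])
    then show ?thesis by (simp add: algebra_simps)
  qed
  have "qnum q c = (q powr (- c / 2) * (1 - q powr c)) / (q powr (- 1 / 2) * (1 - q))"
    using num[of c] num[of 1] assms by (simp add: qnum_def)
  also have "\<dots> = q powr (- c / 2) / q powr (- 1 / 2) * (1 - q powr c) / (1 - q)"
    by simp
  also have "q powr (- c / 2) / q powr (- 1 / 2) = q powr ((1 - c) / 2)"
    by (simp add: powr_diff[symmetric] diff_divide_distrib)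
  finally show ?thesis .
qed

locale wall_representation = discrete_series q l for q l :: real +
  fixes \<psi> :: real
begin

text \<open>The rewrite states all facts about the polynomials in terms of q^(2l), the parameter of
  the representation; \<open>l_pos\<close> becomes the condition on
  \<open>\<alpha> * q\<close>.\<close>

sublocale wall q "q powr (2 * l - 1)"
  rewrites "q powr (2 * l - 1) * q = q powr (2 * l)"
proof -
  have eq: "q powr (2 * l - 1) * q = q powr (2 * l)"
    using q_pos by (simp add: powr_diff)
  show "wall q (q powr (2 * l - 1))"
    using q_pos q_less_1 l_pos powr_less_mono2[of "2 * l" q 1] eq by unfold_locales auto
  show "q powr (2 * l - 1) * q = q powr (2 * l)" by (rule eq)
qed

section \<open>The operator as a Jacobi matrix\<close>

abbreviation (input) T :: "complex fps \<Rightarrow> complex fps" where "T \<equiv> I2 q l \<psi>"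
abbreviation (input) a :: real where "a \<equiv> q powr (2 * l)"

text \<open>Here -r = 1 / (1 - 1/q), so the claimed eigenvalues are -r q^n. Accordingly the matrix
  will be -r times that of multiplication by the variable.\<close>

definition r :: real where "r = q / (1 - q)"

definition b :: "nat \<Rightarrow> real" where "b n = r * \<beta> n"

definition d :: "nat \<Rightarrow> real" where "d n = r * (A n + C n)"

lemma r_pos: "r > 0"
  using q_pos q_less_1 by (simp add: r_def)

text \<open>The square root contributes q^((1-2l-2m)/4); with the two weights at m and m + 1 the
  exponents add up to l + m + 1. The same number is the lowering entry from m + 1 to m.\<close>

lemma raising_coeff:
  "q powr (3 * (l + real (Suc m)) / 4) * (sqrt (qnum q (2 * l + real m) * qnum q (real m + 1)) * q powr (3 * (l + real m) / 4)) = b m"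
proof -
  define u where "u = 1 - a * q ^ m"
  define v where "v = 1 - q * q ^ m"
  have u: "1 - q powr (2 * l + real m) = u" and v: "1 - q powr (real m + 1) = v"
    using q_pos by (simp_all add: u_def v_def powr_add powr_realpow mult.commute)
  have "qnum q (2 * l + real m) * qnum q (real m + 1)
      = (q powr ((1 - (2 * l + real m)) / 2) * q powr ((1 - (real m + 1)) / 2)) * (u * v) / (1 - q)\<^sup>2"
    unfolding qnum_eq[OF q_pos] u v by (simp add: power2_eq_square)
  also have "q powr ((1 - (2 * l + real m)) / 2) * q powr ((1 - (real m + 1)) / 2) = q powr (2 * ((1 - 2 * l - 2 * real m) / 4))"
  proof -
    have "(1 - (2 * l + real m)) / 2 + (1 - (real m + 1)) / 2 = 2 * ((1 - 2 * l - 2 * real m) / 4)"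
      by (simp add: field_simps)
    then show ?thesis unfolding powr_add[symmetric] by (simp only:)
  qed
  also have "\<dots> = (q powr ((1 - 2 * l - 2 * real m) / 4))\<^sup>2"
    by (simp only: power2_eq_square powr_add[symmetric] mult_2)
  finally have s: "sqrt (qnum q (2 * l + real m) * qnum q (real m + 1)) = q powr ((1 - 2 * l - 2 * real m) / 4) * sqrt (u * v) / (1 - q)"
    using q_less_1 by (simp add: real_sqrt_mult real_sqrt_divide)
  have "q powr (3 * (l + real (Suc m)) / 4) * q powr ((1 - 2 * l - 2 * real m) / 4) * q powr (3 * (l + real m) / 4) = q powr (l + real m + 1)"
  proof -
    have "3 * (l + real (Suc m)) / 4 + (1 - 2 * l - 2 * real m) / 4 + 3 * (l + real m) / 4 = l + real m + 1"
      by (simp add: field_simps)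
    then show ?thesis unfolding powr_add[symmetric] by (simp only:)
  qed
  also have "\<dots> = q * q ^ m * sqrt a"
    using q_pos by (simp add: powr_add powr_realpow powr_half_sqrt[symmetric] powr_powr)
  finally have e: "q powr (3 * (l + real (Suc m)) / 4) * q powr ((1 - 2 * l - 2 * real m) / 4) * q powr (3 * (l + real m) / 4) = q * q ^ m * sqrt a" .
  have "q powr (3 * (l + real (Suc m)) / 4) * (sqrt (qnum q (2 * l + real m) * qnum q (real m + 1)) * q powr (3 * (l + real m) / 4))
      = (q powr (3 * (l + real (Suc m)) / 4) * q powr ((1 - 2 * l - 2 * real m) / 4) * q powr (3 * (l + real m) / 4)) * sqrt (u * v) / (1 - q)"
    unfolding s by (simp only: times_divide_eq_left times_divide_eq_right mult_ac)
  also have "\<dots> = b m"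
    unfolding e b_def r_def \<beta>_def u_def v_def by (simp add: real_sqrt_mult)
  finally show ?thesis .
qed

text \<open>After collecting exponents, the first summand is \<open>r * C n\<close> and the second
  is \<open>r * A n\<close>.\<close>

lemma diagonal_coeff:
  "q powr ((l - 1) / 2) * (qnum q (l + real n - l) * q powr (3 * (l + real n) / 2))
     + q powr (- (l - 1) / 2) * (qnum q (l + real n + l) * q powr (3 * (l + real n) / 2)) = d n"
proof -
  have 1: "q powr ((l - 1) / 2) * (q powr ((1 - real n) / 2) * q powr (3 * (l + real n) / 2)) = a * q ^ n"
  proof -
    have "(l - 1) / 2 + ((1 - real n) / 2 + 3 * (l + real n) / 2) = 2 * l + real n"
      by (simp add: field_simps)
    then have "q powr ((l - 1) / 2) * (q powr ((1 - real n) / 2) * q powr (3 * (l + real n) / 2)) = q powr (2 * l + real n)"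
      unfolding powr_add[symmetric] by (simp only:)
    then show ?thesis
      using q_pos by (simp add: powr_add powr_realpow)
  qed
  have 2: "q powr (- (l - 1) / 2) * (q powr ((1 - (l + real n + l)) / 2) * q powr (3 * (l + real n) / 2)) = q * q ^ n"
  proof -
    have "- (l - 1) / 2 + ((1 - (l + real n + l)) / 2 + 3 * (l + real n) / 2) = 1 + real n"
      by (simp add: field_simps)
    then have "q powr (- (l - 1) / 2) * (q powr ((1 - (l + real n + l)) / 2) * q powr (3 * (l + real n) / 2)) = q powr (1 + real n)"
      unfolding powr_add[symmetric] by (simp only:)
    then show ?thesis
      using q_pos by (simp add: powr_add powr_realpow)
  qed
  have 3: "1 - q powr real n = 1 - q ^ n" "1 - q powr (l + real n + l) = 1 - a * q ^ n" "l + real n - l = real n"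
  proof -
    have "l + real n - l = real n" "l + real n + l = 2 * l + real n" by simp_all
    then show "1 - q powr real n = 1 - q ^ n" "1 - q powr (l + real n + l) = 1 - a * q ^ n" "l + real n - l = real n"
      using q_pos by (simp_all add: powr_add powr_realpow)
  qed
  have "q powr ((l - 1) / 2) * (qnum q (l + real n - l) * q powr (3 * (l + real n) / 2))
      = q powr ((l - 1) / 2) * (q powr ((1 - real n) / 2) * q powr (3 * (l + real n) / 2)) * (1 - q ^ n) / (1 - q)"
    unfolding qnum_eq[OF q_pos] 3 by simp
  moreover have "q powr (- (l - 1) / 2) * (qnum q (l + real n + l) * q powr (3 * (l + real n) / 2))
      = q powr (- (l - 1) / 2) * (q powr ((1 - (l + real n + l)) / 2) * q powr (3 * (l + real n) / 2)) * (1 - a * q ^ n) / (1 - q)"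
    unfolding qnum_eq[OF q_pos] 3 by simp
  moreover have "a * q ^ n * (1 - q ^ n) / (1 - q) + q * q ^ n * (1 - a * q ^ n) / (1 - q) = d n"
  proof -
    have "q * q powr (2 * l - 1) = a"
      using q_pos by (simp add: powr_diff)
    then have "q * C n = a * q ^ n * (1 - q ^ n)"
      by (simp add: C_def mult.assoc[symmetric])
    moreover have "q * A n = q * q ^ n * (1 - a * q ^ n)"
      by (simp add: A_def)
    moreover have "d n = q * C n / (1 - q) + q * A n / (1 - q)"
      by (simp add: d_def r_def add_divide_distrib distrib_left)
    ultimately show ?thesis
      by (simp only:)
  qed
  ultimately show ?thesis
    unfolding 1 2 by (simp only:)
qed

text \<open>Boundedness, symmetry and the eigenvector equation are all read off from this
  tridiagonal form.\<close>

lemma coord_T: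
  "co (T F) n = (case n of 0 \<Rightarrow> 0 | Suc m \<Rightarrow> exp (\<i> * \<psi>) * b m * co F m)
     + exp (- \<i> * \<psi>) * b n * co F (Suc n) - d n * co F n"
proof -
  have up: "(case n of 0 \<Rightarrow> 0 | Suc m \<Rightarrow> exp (\<i> * \<psi>) * b m * co F m) =
      of_real (q powr (3 * (l + real n) / 4)) * (exp (\<i> * \<psi>) * (case n of 0 \<Rightarrow> 0 | Suc m \<Rightarrow>
        of_real (sqrt (qnum q (2 * l + real m) * qnum q (real m + 1))) * (of_real (q powr (3 * (l + real m) / 4)) * co F m)))"
    by (cases n) (simp_all only: raising_coeff[symmetric] of_real_mult nat.case mult_ac mult_zero_left)
  have down: "exp (- \<i> * \<psi>) * b n * co F (Suc n) = of_real (q powr (3 * (l + real n) / 4)) * (exp (- \<i> * \<psi>) *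
      (of_real (sqrt (qnum q (2 * l + real (Suc n) - 1) * qnum q (real (Suc n)))) * (of_real (q powr (3 * (l + real (Suc n)) / 4)) * co F (Suc n))))"
  proof -
    have "2 * l + real (Suc n) - 1 = 2 * l + real n" "real (Suc n) = real n + 1" by simp_all
    then show ?thesis
      by (simp only: raising_coeff[symmetric] of_real_mult mult_ac)
  qed
  have diag: "d n * co F n = of_real (q powr ((l - 1) / 2)) * (of_real (qnum q (l + real n - l)) * (of_real (q powr (3 * (l + real n) / 2)) * co F n))
     + of_real (q powr (- (l - 1) / 2)) * (of_real (qnum q (l + real n + l)) * (of_real (q powr (3 * (l + real n) / 2)) * co F n))"
    unfolding diagonal_coeff[symmetric] by (simp only: of_real_mult of_real_add distrib_right mult.assoc)
  show ?thesis
    unfolding up down diag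
    by (simp only: I2_def Let_def coord_diff coord_add f_coord_cscale fun_J0_def J_plus_def J_minus_def coord_series distrib_left)
qed

section \<open>Boundedness and symmetry\<close>

lemma b_bounds: "\<bar>b n\<bar> \<le> r"
proof -
  have "sqrt (a * (1 - a * q ^ n) * (1 - q ^ Suc n)) \<le> sqrt 1"
  proof (rule real_sqrt_le_mono)
    have "a * (1 - a * q ^ n) \<le> 1 * 1"
      using aq_power_less_1[of n] \<alpha>q_less_1 q_pos by (intro mult_mono) auto
    then have "a * (1 - a * q ^ n) * (1 - q ^ Suc n) \<le> 1 * 1"
      using q_power_Suc_less_1[of n] q_pos by (intro mult_mono) auto
    then show "a * (1 - a * q ^ n) * (1 - q ^ Suc n) \<le> 1" by simp
  qed
  moreover have "q ^ n \<le> 1" using q_pos q_less_1 by (simp add: power_le_one)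
  ultimately have "\<beta> n \<le> 1 * 1"
    unfolding \<beta>_def using q_pos \<beta>_pos[of n] aq_power_less_1[of n] q_power_Suc_less_1[of n]
    by (intro mult_mono) auto
  then show ?thesis using r_pos \<beta>_pos[of n] by (simp add: b_def mult_left_le)
qed

lemma d_bounds: "\<bar>d n\<bar> \<le> r * (1 + q powr (2 * l - 1))"
proof -
  have qn: "q ^ n \<le> 1" "0 < q ^ n" using q_pos q_less_1 by (simp_all add: power_le_one)
  have "A n \<le> 1 * 1"
    unfolding A_def using qn aq_power_less_1[of n] q_pos by (intro mult_mono) auto
  moreover have "C n \<le> q powr (2 * l - 1) * 1 * 1"
    unfolding C_def using qn q_pos by (intro mult_mono) auto
  moreover have "0 \<le> A n" "0 \<le> C n"
    using qn aq_power_less_1[of n] by (simp_all add: A_def C_def)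
  ultimately show ?thesis
    using r_pos by (simp add: d_def abs_mult)
qed

lemma T_bounded:
  obtains K where "\<And>F. F \<in> \<H> \<Longrightarrow> T F \<in> \<H>" "\<And>F. F \<in> \<H> \<Longrightarrow> nm (T F) \<le> K * nm F"
proof -
  define D where "D = r * (1 + q powr (2 * l - 1))"
  define K where "K = 3 * (2 * r\<^sup>2 + D\<^sup>2)"
  have K: "K \<ge> 0" by (simp add: K_def)
  have main: "T F \<in> \<H> \<and> (nm (T F))\<^sup>2 \<le> K * (nm F)\<^sup>2" if F: "F \<in> \<H>" for F
  proof -
    define s where "s n = (cmod (co F n))\<^sup>2" for n
    define S where "S = suminf s"
    have s: "s sums S"
      using F by (simp add: s_def[abs_def] S_def hl_space_def summable_sums)
    \<comment> \<open>A majorant of the squared coordinates of \<open>T F\<close>, from (x + y +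
      z)^2 <= 3 (x^2 + y^2 + z^2). Its lowering part misses \<open>s 0\<close>, which only decreases
      the sum.\<close>
    define t where "t n = 3 * (r\<^sup>2 * (case n of 0 \<Rightarrow> 0 | Suc m \<Rightarrow> s m) + r\<^sup>2 * s (Suc n) + D\<^sup>2 * s n)" for n
    have t: "t sums (3 * (r\<^sup>2 * S + r\<^sup>2 * (S - s 0) + D\<^sup>2 * S))"
      unfolding t_def using s sums_case_nat_shift[of s S]
      by (intro sums_mult sums_add) (simp_all add: sums_Suc_iff)
    have le: "(cmod (co (T F) n))\<^sup>2 \<le> t n" for n
    proof -
      define x where "x = (case n of 0 \<Rightarrow> 0 | Suc m \<Rightarrow> cmod (co F m))"
      define y where "y = cmod (co F (Suc n))"
      define z where "z = cmod (co F n)"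
      have nn: "x \<ge> 0" "y \<ge> 0" "z \<ge> 0" by (auto simp: x_def y_def z_def split: nat.split)
      have "cmod (case n of 0 \<Rightarrow> 0 | Suc m \<Rightarrow> exp (\<i> * \<psi>) * b m * co F m) \<le> r * x"
        using b_bounds by (auto simp: norm_mult x_def mult_right_mono split: nat.split)
      moreover have "cmod (exp (- \<i> * \<psi>) * b n * co F (Suc n)) \<le> r * y"
        using b_bounds by (simp add: norm_mult y_def mult_right_mono)
      moreover have "cmod (d n * co F n) \<le> D * z"
        using d_bounds by (simp add: norm_mult z_def D_def mult_right_mono)
      ultimately have "cmod (co (T F) n) \<le> r * x + r * y + D * z"
        unfolding coord_T by (intro norm_triangle_mono order_trans[OF norm_triangle_ineq4] add_mono) auto
      then have "(cmod (co (T F) n))\<^sup>2 \<le> (r * x + r * y + D * z)\<^sup>2"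
        by (intro power_mono) auto
      also have "\<dots> \<le> 3 * ((r * x)\<^sup>2 + (r * y)\<^sup>2 + (D * z)\<^sup>2)"
      proof -
        have "0 \<le> (r * x - r * y)\<^sup>2 + (r * x - D * z)\<^sup>2 + (r * y - D * z)\<^sup>2" by simp
        then show ?thesis by (simp add: power2_eq_square algebra_simps)
      qed
      also have "\<dots> = t n"
        by (simp add: t_def x_def y_def z_def s_def power_mult_distrib split: nat.split)
      finally show ?thesis .
    qed
    have in_H: "T F \<in> \<H>"
      unfolding hl_space_def using le
      by (auto intro!: summable_comparison_test'[OF sums_summable[OF t]])
    moreover have "(nm (T F))\<^sup>2 \<le> K * (nm F)\<^sup>2"
    proof -
      have "(nm (T F))\<^sup>2 \<le> suminf t"
        using in_H le t unfolding nm_squared[OF in_H]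
        by (intro suminf_le) (auto simp: hl_space_def sums_iff)
      also have "\<dots> = 3 * (r\<^sup>2 * S + r\<^sup>2 * (S - s 0) + D\<^sup>2 * S)"
        using t by (simp add: sums_iff)
      also have "\<dots> \<le> K * S"
        by (simp add: K_def s_def algebra_simps)
      also have "S = (nm F)\<^sup>2"
        by (simp add: nm_squared[OF F] S_def s_def[abs_def])
      finally show ?thesis .
    qed
    ultimately show ?thesis by blast
  qed
  show ?thesis
  proof (rule that[of "sqrt K"])
    fix F assume F: "F \<in> \<H>"
    show "T F \<in> \<H>" using main[OF F] by simp
    have "sqrt ((nm (T F))\<^sup>2) \<le> sqrt (K * (nm F)\<^sup>2)"
      using main[OF F] by (intro real_sqrt_le_mono) simp
    then show "nm (T F) \<le> sqrt K * nm F"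
      using main[OF F] F nm_nonneg by (simp add: real_sqrt_mult)
  qed
qed

lemma T_add: "T (F + G) = T F + T G"
  by (rule coord_eqI) (simp add: coord_T algebra_simps split: nat.split)

lemma T_cscale: "T (cscale c F) = cscale c (T F)"
  by (rule coord_eqI) (simp add: coord_T algebra_simps split: nat.split)

lemma T_symmetric:
  assumes F: "F \<in> \<H>" and G: "G \<in> \<H>"
  shows "ip (T F) G = ip F (T G)"
proof -
  define e where "e = exp (\<i> * \<psi>)"
  have e: "exp (- \<i> * \<psi>) = cnj e"
  proof -
    have "exp (- \<i> * \<psi>) = cis (- \<psi>)" by (simp add: cis_conv_exp)
    then show ?thesis by (simp add: e_def cis_conv_exp[symmetric] cis_cnj)
  qed
  \<comment> \<open>A left shift with bounded weights preserves the space, so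
    \<open>summable_inner\<close> yields the convergence of X and Y.\<close>
  have shift_in: "f_series q l (\<lambda>n. c n * co H (Suc n)) \<in> \<H>" if "H \<in> \<H>" "\<And>n. cmod (c n) \<le> r" for c H
  proof -
    have summable: "summable (\<lambda>n. r\<^sup>2 * (cmod (co H (Suc n)))\<^sup>2)"
      using that(1) by (intro summable_mult) (simp add: hl_space_def summable_Suc_iff[of "\<lambda>n. (cmod (co H n))\<^sup>2"])
    have "(cmod (c n * co H (Suc n)))\<^sup>2 \<le> r\<^sup>2 * (cmod (co H (Suc n)))\<^sup>2" for n
      using that(2)[of n] by (simp add: norm_mult power_mult_distrib mult_right_mono power_mono)
    then show ?thesis
      unfolding hl_space_def mem_Collect_eq coord_series
      by (intro summable_comparison_test'[OF summable]) simp
  qed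
  \<comment> \<open>X arises from raising F and equally from lowering G; Y from lowering F and
    equally from raising G; Z is the diagonal part.\<close>
  define X where "X = (\<Sum>n. e * b n * co F n * cnj (co G (Suc n)))"
  define Y where "Y = (\<Sum>n. cnj e * b n * co F (Suc n) * cnj (co G n))"
  define Z where "Z = (\<Sum>n. d n * co F n * cnj (co G n))"
  have be: "cmod (cnj e * b n) \<le> r" for n
    using b_bounds[of n] by (simp add: norm_mult e_def)
  have X: "(\<lambda>n. e * b n * co F n * cnj (co G (Suc n))) sums X"
    unfolding X_def
    using summable_inner[OF F shift_in[of G "\<lambda>n. cnj e * b n", OF G be]]
    by (intro summable_sums) (simp add: coord_series mult_ac)
  have Y: "(\<lambda>n. cnj e * b n * co F (Suc n) * cnj (co G n)) sums Y"
    unfolding Y_def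
    using summable_inner[OF shift_in[of F "\<lambda>n. cnj e * b n", OF F be] G]
    by (intro summable_sums) (simp add: coord_series)
  have Z: "(\<lambda>n. d n * co F n * cnj (co G n)) sums Z"
    unfolding Z_def
  proof (rule summable_sums, rule summable_norm_cancel, rule summable_comparison_test')
    show "summable (\<lambda>n. r * (1 + q powr (2 * l - 1)) * ((cmod (co F n))\<^sup>2 + (cmod (co G n))\<^sup>2))"
      using F G by (intro summable_mult summable_add) (auto simp: hl_space_def)
    fix n
    have "cmod (co F n) * cmod (co G n) \<le> (cmod (co F n))\<^sup>2 + (cmod (co G n))\<^sup>2"
      using sum_squares_bound[of "cmod (co F n)" "cmod (co G n)", unfolded mult.assoc]
        mult_nonneg_nonneg[OF norm_ge_zero norm_ge_zero, of "co F n" "co G n"] by linarith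
    then have "\<bar>d n\<bar> * (cmod (co F n) * cmod (co G n)) \<le> r * (1 + q powr (2 * l - 1)) * ((cmod (co F n))\<^sup>2 + (cmod (co G n))\<^sup>2)"
      using d_bounds[of n] by (intro mult_mono) auto
    then show "norm (norm (d n * co F n * cnj (co G n))) \<le> r * (1 + q powr (2 * l - 1)) * ((cmod (co F n))\<^sup>2 + (cmod (co G n))\<^sup>2)"
      by (simp add: norm_mult mult.assoc)
  qed
  have "(\<lambda>n. co (T F) n * cnj (co G n)) =
     (\<lambda>n. (case n of 0 \<Rightarrow> 0 | Suc m \<Rightarrow> e * b m * co F m * cnj (co G (Suc m)))
        + cnj e * b n * co F (Suc n) * cnj (co G n) - d n * co F n * cnj (co G n))"
    unfolding coord_T e e_def[symmetric] by (auto simp: fun_eq_iff algebra_simps split: nat.split)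
  moreover have "\<dots> sums (X + Y - Z)"
    using X Y Z by (intro sums_add sums_diff) (simp_all add: sums_case_nat_shift)
  ultimately have 1: "ip (T F) G = X + Y - Z"
    by (simp add: hl_inner_def sums_iff)
  have "(\<lambda>n. co F n * cnj (co (T G) n)) =
     (\<lambda>n. e * b n * co F n * cnj (co G (Suc n))
        + (case n of 0 \<Rightarrow> 0 | Suc m \<Rightarrow> cnj e * b m * co F (Suc m) * cnj (co G m)) - d n * co F n * cnj (co G n))"
    unfolding coord_T e e_def[symmetric] by (auto simp: fun_eq_iff algebra_simps split: nat.split)
  moreover have "\<dots> sums (X + Y - Z)"
    using X Y Z by (intro sums_add sums_diff) (simp_all add: sums_case_nat_shift)
  ultimately have 2: "ip F (T G) = X + Y - Z"
    by (simp add: hl_inner_def sums_iff)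
  show ?thesis using 1 2 by simp
qed

section \<open>The eigenvectors\<close>

lemma I2_ev_eq: "I2_ev q n = - r * q ^ n"
  using q_pos q_less_1 by (simp add: I2_ev_def r_def field_simps)

lemma I2_ev_inj: "I2_ev q m = I2_ev q n \<Longrightarrow> m = n"
  using r_pos q_pos q_less_1 by (simp add: I2_ev_eq power_inject_exp')

text \<open>The factor \<open>1 - inverse q\<close> turns the eigenvalue into q^n, and q^(-lk) is
  the reciprocal square root of (q^(2l))^k in the normalisation of \<open>u\<close>.\<close>

lemma P_coeff_eq: "P_coeff q l \<psi> k (I2_ev q n) = exp (\<i> * of_nat k * \<psi>) * u k (q ^ n)"
proof -
  have "(1 - inverse q) * I2_ev q n = q ^ n"
    using q_pos q_less_1 by (simp add: I2_ev_def)
  moreover have "sqrt (qpoch a q k / qpoch q q k) * q powr (- l * real k) = sqrt (qpoch a q k / (qpoch q q k * a ^ k))"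
  proof -
    have "sqrt (a ^ k) = q powr (l * real k)"
      using q_pos by (simp add: powr_realpow[symmetric] powr_half_sqrt[symmetric] powr_powr)
    then show ?thesis
      using q_pos by (simp add: real_sqrt_divide real_sqrt_mult powr_minus field_simps)
  qed
  ultimately show ?thesis
    by (simp only: P_coeff_def u_def)
qed

lemma coord_Xi: "co (Xi q l \<psi> n) k = exp (\<i> * of_nat k * \<psi>) * u k (q ^ n)"
  by (simp add: Xi_def coord_series P_coeff_eq)

lemma norm_coord_Xi: "(cmod (co (Xi q l \<psi> n) k))\<^sup>2 = (u k (q ^ n))\<^sup>2"
proof -
  have "cmod (exp (\<i> * of_nat k * \<psi>)) = 1" by simp
  then show ?thesis by (simp only: coord_Xi norm_mult norm_of_real power2_abs mult_1_left)
qed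

lemma Xi_in: "Xi q l \<psi> n \<in> \<H>"
  unfolding hl_space_def mem_Collect_eq norm_coord_Xi
  by (rule summableI_nonneg_bounded[of _ "E / w n"]) (auto simp: sum_u_squared_le)

lemma nm_Xi: "(nm (Xi q l \<psi> n))\<^sup>2 \<le> E / w n"
  unfolding nm_squared[OF Xi_in] norm_coord_Xi
  using Xi_in[of n] by (intro suminf_le_const sum_u_squared_le) (simp add: hl_space_def norm_coord_Xi)

lemma Xi_nonzero: "Xi q l \<psi> n \<noteq> 0"
proof
  assume "Xi q l \<psi> n = 0"
  then have "co (Xi q l \<psi> n) 0 = 0" by simp
  then show False by (simp add: coord_Xi)
qed

lemma T_Xi: "T (Xi q l \<psi> n) = cscale (of_real (I2_ev q n)) (Xi q l \<psi> n)"
proof (rule coord_eqI)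
  fix k
  \<comment> \<open>The phases of the operator shift the index of e by one, so \<open>e k\<close>
    factors out of the whole row and -r times \<open>u_recurrence\<close> remains.\<close>
  define e where "e k = exp (\<i> * of_nat k * \<psi>)" for k :: nat
  have e1: "exp (\<i> * \<psi>) * e m = e (Suc m)" for m
    by (simp add: e_def exp_add[symmetric] algebra_simps)
  have e2: "exp (- \<i> * \<psi>) * e (Suc m) = e m" for m
    by (simp add: e_def exp_add[symmetric] algebra_simps)
  have up: "(case k of 0 \<Rightarrow> 0 | Suc m \<Rightarrow> exp (\<i> * \<psi>) * b m * (e m * u m (q ^ n)))
      = e k * of_real (case k of 0 \<Rightarrow> 0 | Suc m \<Rightarrow> b m * u m (q ^ n))"
    by (cases k) (simp_all add: e1[symmetric] mult_ac)
  have down: "exp (- \<i> * \<psi>) * b k * (e (Suc k) * u (Suc k) (q ^ n)) = e k * of_real (b k * u (Suc k) (q ^ n))"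
    unfolding e2[of k, symmetric] by (simp only: of_real_mult mult_ac)
  have "co (T (Xi q l \<psi> n)) k = e k * of_real ((case k of 0 \<Rightarrow> 0 | Suc m \<Rightarrow> b m * u m (q ^ n)) + b k * u (Suc k) (q ^ n) - d k * u k (q ^ n))"
    unfolding coord_T coord_Xi e_def[symmetric] up down by (simp add: algebra_simps)
  also have "(case k of 0 \<Rightarrow> 0 | Suc m \<Rightarrow> b m * u m (q ^ n)) + b k * u (Suc k) (q ^ n) - d k * u k (q ^ n)
      = - r * (q ^ n * u k (q ^ n))"
    unfolding u_recurrence[of "q ^ n" k] by (cases k) (simp_all add: b_def d_def algebra_simps)
  finally show "co (T (Xi q l \<psi> n)) k = co (cscale (of_real (I2_ev q n)) (Xi q l \<psi> n)) k"
    by (simp only: f_coord_cscale coord_Xi I2_ev_eq e_def of_real_mult mult_ac)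
qed

text \<open>Stated for any complex \<mu>, as it serves three purposes: orthogonality of the system,
  simplicity of the eigenvalues, and exclusion of further ones.\<close>

lemma eigenvector_orthogonal_Xi:
  assumes F: "F \<in> \<H>" and TF: "T F = cscale \<mu> F" and ne: "\<mu> \<noteq> of_real (I2_ev q n)"
  shows "ip F (Xi q l \<psi> n) = 0"
proof -
  have "\<mu> * ip F (Xi q l \<psi> n) = ip (T F) (Xi q l \<psi> n)"
    using F Xi_in by (simp add: TF ip_cscale_left)
  also have "\<dots> = of_real (I2_ev q n) * ip F (Xi q l \<psi> n)"
    using F Xi_in by (simp add: T_symmetric T_Xi ip_cscale_right)
  finally show ?thesis using ne by simp
qed

lemma Xi_orthogonal: "m \<noteq> n \<Longrightarrow> ip (Xi q l \<psi> m) (Xi q l \<psi> n) = 0"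
  using I2_ev_inj by (intro eigenvector_orthogonal_Xi[OF Xi_in T_Xi]) auto

text \<open>
  The coefficients are those of the expansion of \<^term>\<open>f_basis q l j\<close> in the \<^term>\<open>Xi q l \<psi> n\<close>, with
  the bound \<^term>\<open>E / w n\<close> in place of the squared norm.
\<close>
lemma Xi_dense: "hl_dense_span q l (range (Xi q l \<psi>))"
proof (rule dense_spanI)
  show "range (Xi q l \<psi>) \<subseteq> \<H>" using Xi_in by auto
  fix j and e :: real assume e: "e > 0"
  define c where "c n = of_real (w n / E) * cnj (co (Xi q l \<psi> n) j)" for n
  define G where "G N = (\<Sum>n<N. cscale (c n) (Xi q l \<psi> n))" for N
  define s where "s N = (\<Sum>n<N. w n * (u j (q ^ n) * u j (q ^ n))) / E" for N
  have G_in: "G N \<in> \<H>" for N by (auto simp: G_def intro!: sum_in cscale_in Xi_in)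
  have norm_c: "(cmod (c n))\<^sup>2 = (w n / E)\<^sup>2 * (u j (q ^ n))\<^sup>2" for n
    by (simp add: c_def norm_mult power_mult_distrib norm_coord_Xi power_divide norm_divide)
  have "ip (f_basis q l j) (G N) = of_real (s N)" for N
  proof -
    have "ip (f_basis q l j) (G N) = (\<Sum>n<N. cnj (c n) * cnj (co (Xi q l \<psi> n) j))"
      unfolding G_def by (subst ip_sum_right) (auto simp: basis_in Xi_in cscale_in ip_basis_left)
    also have "\<dots> = (\<Sum>n<N. of_real (w n * (u j (q ^ n) * u j (q ^ n)) / E))"
    proof (rule sum.cong)
      fix n
      have "cnj (c n) * cnj (co (Xi q l \<psi> n) j) = of_real (w n / E) * (co (Xi q l \<psi> n) j * cnj (co (Xi q l \<psi> n) j))"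
        by (simp add: c_def)
      also have "\<dots> = of_real (w n / E * (u j (q ^ n))\<^sup>2)"
        by (simp only: complex_norm_square[symmetric] norm_coord_Xi of_real_mult)
      finally show "cnj (c n) * cnj (co (Xi q l \<psi> n) j) = of_real (w n * (u j (q ^ n) * u j (q ^ n)) / E)"
        by (simp add: power2_eq_square)
    qed simp
    finally show ?thesis by (simp add: s_def sum_divide_distrib)
  qed
  moreover have "(nm (G N))\<^sup>2 \<le> s N" for N
  proof -
    have "(nm (G N))\<^sup>2 = (\<Sum>n<N. (nm (cscale (c n) (Xi q l \<psi> n)))\<^sup>2)"
      unfolding G_def
      by (rule nm_sum_squared) (auto simp: cscale_in Xi_in ip_cscale_left ip_cscale_right Xi_orthogonal)
    also have "\<dots> \<le> (\<Sum>n<N. w n * (u j (q ^ n) * u j (q ^ n)) / E)"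
    proof (rule sum_mono)
      fix n
      have "(nm (cscale (c n) (Xi q l \<psi> n)))\<^sup>2 = (w n / E)\<^sup>2 * (u j (q ^ n))\<^sup>2 * (nm (Xi q l \<psi> n))\<^sup>2"
        by (simp add: nm_cscale Xi_in power_mult_distrib norm_c)
      also have "\<dots> \<le> (w n / E)\<^sup>2 * (u j (q ^ n))\<^sup>2 * (E / w n)"
        by (intro mult_left_mono nm_Xi) simp
      also have "\<dots> = w n * (u j (q ^ n) * u j (q ^ n)) / E"
        using E_pos w_pos[of n] by (simp add: field_simps power2_eq_square)
      finally show "(nm (cscale (c n) (Xi q l \<psi> n)))\<^sup>2 \<le> w n * (u j (q ^ n) * u j (q ^ n)) / E" .
    qed
    finally show ?thesis by (simp add: s_def sum_divide_distrib)
  qed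
  \<comment> \<open>The left-hand side is 1 - 2 s_N + (nm (G N))^2, and the last term is at most
    s_N.\<close>
  ultimately have le: "(nm (f_basis q l j - G N))\<^sup>2 \<le> 1 - s N" for N
    using G_in basis_in nm_basis by (simp add: nm_diff_squared)
  \<comment> \<open>The squared norm of u_j with respect to the masses is E.\<close>
  have "s \<longlonglongrightarrow> E / E"
    unfolding s_def using u_orthonormal[of j j] E_pos by (intro tendsto_divide tendsto_const) (auto simp: sums_def)
  then have "(\<lambda>N. 1 - s N) \<longlonglongrightarrow> 1 - 1"
    using E_pos by (intro tendsto_diff tendsto_const) simp
  then have "eventually (\<lambda>N. 1 - s N < e\<^sup>2) sequentially"
    using e by (intro order_tendstoD) auto
  then obtain N where "1 - s N < e\<^sup>2"
    by (auto simp: eventually_sequentially)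
  with le[of N] have "(nm (f_basis q l j - G N))\<^sup>2 < e\<^sup>2" by linarith
  then have "nm (f_basis q l j - G N) < e"
    using e by (intro power2_less_imp_less[of _ e]) auto
  moreover have "G N \<in> cfps.span (range (Xi q l \<psi>))"
    unfolding G_def by (intro cfps.span_sum cfps.span_scale cfps.span_base) auto
  ultimately show "\<exists>G\<in>cfps.span (range (Xi q l \<psi>)). nm (f_basis q l j - G) < e" by blast
qed

section \<open>Eigenspaces and spectrum\<close>

lemma orthogonal_Xi_eq_0: "F \<in> \<H> \<Longrightarrow> (\<And>n. ip F (Xi q l \<psi> n) = 0) \<Longrightarrow> F = 0"
  by (rule orthogonal_to_dense_eq_0[OF _ Xi_dense]) (auto simp: Xi_in)

lemma eigenvector_Xi: "hl_eigenvector q l T (of_real (I2_ev q n)) (Xi q l \<psi> n)"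
  by (simp add: hl_eigenvector_def hl_eigenspace_def Xi_in T_Xi Xi_nonzero)

text \<open>Subtracting from an eigenvector its projection onto \<open>Xi q l \<psi> n\<close>
  leaves a vector orthogonal to the whole system, hence zero.\<close>

lemma eigenspace_eq: "hl_eigenspace q l T (of_real (I2_ev q n)) = cfps.span {Xi q l \<psi> n}"
proof (intro equalityI subsetI)
  fix F assume "F \<in> hl_eigenspace q l T (of_real (I2_ev q n))"
  then have F: "F \<in> \<H>" and TF: "T F = cscale (of_real (I2_ev q n)) F"
    by (auto simp: hl_eigenspace_def)
  have nz: "ip (Xi q l \<psi> n) (Xi q l \<psi> n) \<noteq> 0"
    using nm_eq_0[OF Xi_in] Xi_nonzero by (auto simp: ip_self_nm Xi_in)
  define c where "c = ip F (Xi q l \<psi> n) / ip (Xi q l \<psi> n) (Xi q l \<psi> n)"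
  have "F - cscale c (Xi q l \<psi> n) = 0"
  proof (rule orthogonal_Xi_eq_0)
    fix m
    show "ip (F - cscale c (Xi q l \<psi> n)) (Xi q l \<psi> m) = 0"
    proof (cases "m = n")
      case True
      then show ?thesis
        using nz by (simp add: ip_diff_left ip_cscale_left F Xi_in cscale_in c_def)
    next
      case False
      then have "ip F (Xi q l \<psi> m) = 0"
        using I2_ev_inj by (intro eigenvector_orthogonal_Xi[OF F TF]) auto
      then show ?thesis
        using False by (simp add: ip_diff_left ip_cscale_left F Xi_in cscale_in Xi_orthogonal)
    qed
  qed (simp add: F Xi_in cscale_in diff_in)
  then have "F = cscale c (Xi q l \<psi> n)" by simp
  then show "F \<in> cfps.span {Xi q l \<psi> n}"
    by (metis cfps.span_scale cfps.span_base insertI1)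
next
  fix F assume "F \<in> cfps.span {Xi q l \<psi> n}"
  then obtain c where "F = cscale c (Xi q l \<psi> n)"
    by (auto simp: cfps.span_singleton)
  then show "F \<in> hl_eigenspace q l T (of_real (I2_ev q n))"
    by (simp add: hl_eigenspace_def cscale_in Xi_in T_cscale T_Xi cfps.scale_left_commute)
qed

lemma eigenvalues: "{\<mu>. \<exists>F. hl_eigenvector q l T \<mu> F} = range (\<lambda>n. of_real (I2_ev q n))"
proof (intro equalityI subsetI)
  fix \<mu> assume "\<mu> \<in> {\<mu>. \<exists>F. hl_eigenvector q l T \<mu> F}"
  then obtain F where F: "F \<in> \<H>" "T F = cscale \<mu> F" "F \<noteq> 0"
    by (auto simp: hl_eigenvector_def hl_eigenspace_def)
  show "\<mu> \<in> range (\<lambda>n. of_real (I2_ev q n))"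
    using orthogonal_Xi_eq_0[OF F(1)] eigenvector_orthogonal_Xi[OF F(1,2)] F(3) by blast
qed (use eigenvector_Xi in blast)

lemma simple_discrete_spectrum:
  "hl_simple_discrete_spectrum q l T (\<lambda>n. of_real (I2_ev q n))"
  unfolding hl_simple_discrete_spectrum_def
proof (intro conjI allI)
  fix n
  have "cfps.independent {Xi q l \<psi> n}"
    using Xi_nonzero by simp
  then show "cfps.dim (hl_eigenspace q l T (of_real (I2_ev q n))) = 1"
    by (simp add: eigenspace_eq cfps.dim_eq_card_independent)
next
  have "cfps.span (range (Xi q l \<psi>)) \<subseteq> cfps.span {F. \<exists>\<mu>. hl_eigenvector q l T \<mu> F}"
    using eigenvector_Xi by (intro cfps.span_mono) blast
  then show "hl_dense_span q l {F. \<exists>\<mu>. hl_eigenvector q l T \<mu> F}"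
    using Xi_dense unfolding hl_dense_span_def by (meson subsetD)
qed (rule eigenvalues)

end

theorem theorem4:
  fixes q l \<psi> :: real
  assumes "0 < q" and "q < 1" and "0 < l" and "0 < \<psi>" and "\<psi> \<le> 2 * pi"
  shows "hl_bounded_selfadjoint q l (I2 q l \<psi>) \<and>
    hl_simple_discrete_spectrum q l (I2 q l \<psi>) (\<lambda>n. of_real (I2_ev q n)) \<and>
    (\<forall>n. hl_sums q l (\<lambda>k. cscale (P_coeff q l \<psi> k (I2_ev q n)) (f_basis q l k)) (Xi q l \<psi> n)) \<and>
    (\<forall>n. hl_eigenvector q l (I2 q l \<psi>) (of_real (I2_ev q n)) (Xi q l \<psi> n)) \<and>
    hl_orthogonal_basis q l (Xi q l \<psi>)"
proof -
  interpret wall_representation q l \<psi>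
    using assms by unfold_locales
  obtain K where "\<And>F. F \<in> hl_space q l \<Longrightarrow> I2 q l \<psi> F \<in> hl_space q l"
      "\<And>F. F \<in> hl_space q l \<Longrightarrow> hl_norm q l (I2 q l \<psi> F) \<le> K * hl_norm q l F"
    by (rule T_bounded) blast
  then have "hl_bounded_selfadjoint q l (I2 q l \<psi>)"
    unfolding hl_bounded_selfadjoint_def using T_add T_cscale T_symmetric by blast
  \<comment> \<open>The values of \<open>P_coeff\<close> are the coordinates of \<open>Xi\<close>,
    so the series is its basis expansion.\<close>
  moreover have "hl_sums q l (\<lambda>k. cscale (P_coeff q l \<psi> k (I2_ev q n)) (f_basis q l k)) (Xi q l \<psi> n)" for n
    using hl_sums_basis[OF Xi_in[of n]] by (simp add: coord_Xi P_coeff_eq)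
  moreover have "hl_orthogonal_basis q l (Xi q l \<psi>)"
    using Xi_in Xi_nonzero Xi_orthogonal Xi_dense by (simp add: hl_orthogonal_basis_def)
  ultimately show ?thesis
    using simple_discrete_spectrum eigenvector_Xi by blast
qed

end
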